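(* Let $d\ge 1$, let $p$ be a fixed prime, and let $e=(\mathbf{e}_1,\dots,\mathbf{e}_u)$ and $f=(\mathbf{1}_{k_1},\dots,\mathbf{1}_{k_v})$ be disjoint tuples of vectors in $\mathbb{N}^d$ (with $k_i\in\{1,\dots,d\}$ for all $i$) such that $|e|=|f|$ and $e$ is $2$-admissible. Assume that the generating function $f_{\mathfrak{S}_{e,f}}(z)=\sum_{m\ge0}\mathfrak{S}_{e,f}(m)z^m$ is annihilated by a differential operator $\mathcal{L}\in\mathbb{Z}_p[z,\theta]$ such that at least one of the following holds: (i) $\mathcal{L}$ is of type I; (ii) $\mathcal{L}$ is of type II and $p-1\in\mathcal{Z}_p(\mathfrak{S}_{e,f})$. Then for all $n\in\mathbb{N}$ and all $g\in\mathfrak{F}_p^d$ we have $$\mathfrak{S}_{e,f}(n)\in p^{\alpha_p(\mathfrak{S}_{e,f},n)}\mathbb{Z}\quad\text{and}\quad \mathfrak{S}^g_{e,f}(n)\in p^{\alpha_p(\mathfrak{S}_{e,f},n)-1}\mathbb{Z}_p.$$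
   Context: $\mathbb{Z}_p$ denotes the $p$-adic integers. $\mathbf{1}_k\in\mathbb{N}^d$ is the vector with $1$ in coordinate $k$ and $0$ elsewhere; $\mathbf{1}=(1,\dots,1)$. For vectors, $\mathbf{m}\cdot\mathbf{n}$ is the usual dot product, $\mathbf{m}\ge\mathbf{n}$ means coordinatewise inequality. For a tuple $e=(\mathbf{e}_1,\dots,\mathbf{e}_u)$, $|e|=\sum_i\mathbf{e}_i$; for $\mathbf{n}\in\mathbb{N}^d$, $|\mathbf{n}|$ is the sum of its coordinates. "Disjoint" means no vector occurs both as a component of $e$ and of $f$. For tuples $e=(\mathbf{e}_1,\dots,\mathbf{e}_u)$, $f=(\mathbf{f}_1,\dots,\mathbf{f}_v)$ put $\mathcal{Q}_{e,f}(\mathbf{n})=\prod_{i=1}^u(\mathbf{e}_i\cdot\mathbf{n})!/\prod_{i=1}^v(\mathbf{f}_i\cdot\mathbf{n})!$, $\mathfrak{S}_{e,f}(m)=\sum_{\mathbf{n}\in\mathbb{N}^d,|\mathbf{n}|=m}\mathcal{Q}_{e,f}(\mathbf{n})$, and for a function $g$, $\mathfrak{S}^g_{e,f}(m)=\sum_{|\mathbf{n}|=m}\mathcal{Q}_{e,f}(\mathbf{n})g(\mathbf{n})$. $e$ is $r$-admissible if there is $s\in\{0,\dots,r\}$ such that: (a) $s=0$ or there exist indices $1\le i_1<\dots<i_s\le u$ with $\mathbf{e}_{i_j}\ge\mathbf{1}$ for all $j$; and (b) $s=r$ or, for every $k\in\{1,\dots,d\}$, there exist indices $1\le i_1<\dots<i_{r-s}\le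 u$ with $\mathbf{e}_{i_j}\ge d\,\mathbf{1}_k$ for all $j$. $\mathfrak{F}_p^d$ is the set of functions $g:\mathbb{N}^d\to\mathbb{Z}_p$ such that for every $K\in\mathbb{N}$ there is a sequence of polynomial functions with coefficients in $\mathbb{Z}_p$ converging pointwise ($p$-adically) to $g$ on $\{0,\dots,K\}^d$. For a $\mathbb{Z}_p$-valued sequence $A$, $\mathcal{Z}_p(A)$ is the set of $v\in\{0,\dots,p-1\}$ with $A(v)\in p\mathbb{Z}_p$, and for $n\in\mathbb{N}$ with base-$p$ expansion $n=\sum_{k=0}^N n_kp^k$ ($n_k\in\{0,\dots,p-1\}$, $n_N\neq0$; for $n=0$ the single digit $0$), $\alpha_p(A,n)$ is the number of $k$ with $n_k\in\mathcal{Z}_p(A)$. $\theta=z\frac{d}{dz}$. An operator $\mathcal{L}=\sum_{k=0}^q z^kP_k(\theta)$ with $P_k\in\mathbb{Z}_p[X]$ is of type I if $P_0(\mathbb{Z}_p^\times)\subset\mathbb{Z}_p^\times$ and $P_k(X)\in\prod_{i=1}^{k-1}(X+i)^2\,\mathbb{Z}_p[X]$ for all $k\in\{2,\dots,q\}$; it is of type II if $q=2$, $P_0(\mathbb{Z}_p^\times)\subset\mathbb{Z}_p^\times$ and $P_2(X)\in(X+1)\mathbb{Z}_p[X]$. *)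

theory Defs
  imports
    "HOL-Analysis.Analysis"
    "HOL-Computational_Algebra.Computational_Algebra"
    "HOL-Library.Poly_Mapping"
begin

no_notation fps_nth (infixl \<open>$\<close> 75)

class prime_card =
  assumes prime_card: "prime CARD('a)"

text \<open>
  The prime is \<open>p = CARD('p)\<close> for a type \<open>'p\<close> of class \<^class>\<open>prime_card\<close>.  An element of
  \<open>'p padic_int\<close> is a point of the inverse limit of the rings of integers modulo \<open>p ^ n\<close>:
  \<open>residue x n\<close> is the representative in \<open>{0..<p ^ n}\<close> of its class modulo \<open>p ^ n\<close>.
\<close>

typedef ('p::prime_card) padic_int =
  "{x :: nat \<Rightarrow> int. \<forall>n. x n = x (Suc n) mod int CARD('p) ^ n}"
  morphisms residue Abs_padic_int
  by (rule exI[of _ "\<lambda>_. 0"]) simp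

setup_lifting type_definition_padic_int

lemma padic_prime_pos [simp]: "0 < CARD('p::prime_card)"
  using prime_card[where 'a = 'p] prime_gt_0_nat by blast

lemma padic_prime_gt_1: "1 < int CARD('p::prime_card)"
  using prime_card[where 'a = 'p] prime_gt_1_nat by simp

lemma padic_mod_Suc_mod: "(a mod int q ^ Suc n) mod int q ^ n = a mod int q ^ n"
  by (rule mod_mod_cancel) (simp add: le_imp_power_dvd)

lemma residue_Suc_mod: "residue (x :: 'p::prime_card padic_int) (Suc n) mod int CARD('p) ^ n = residue x n"
  using residue[of x] unfolding mem_Collect_eq by metis

lemma residue_mod [simp]:
  "residue (x :: 'p::prime_card padic_int) n mod int CARD('p) ^ n = residue x n"
  by (metis residue_Suc_mod mod_mod_trivial)

lemma residue_mod_le: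
  assumes "n \<le> m"
  shows "residue (x :: 'p::prime_card padic_int) m mod int CARD('p) ^ n = residue x n"
  using assms
proof (induction m rule: dec_induct)
  case (step m)
  have "residue x (Suc m) mod int CARD('p) ^ n
        = residue x (Suc m) mod int CARD('p) ^ m mod int CARD('p) ^ n"
    by (rule mod_mod_cancel[symmetric]) (use step in \<open>simp add: le_imp_power_dvd\<close>)
  then show ?case using step by (simp add: residue_Suc_mod)
qed simp

lemma padic_int_eq_iff: "x = y \<longleftrightarrow> (\<forall>n. residue x n = residue y n)"
  by (simp only: residue_inject[symmetric] fun_eq_iff)

instantiation padic_int :: (prime_card) comm_ring_1
begin

lift_definition zero_padic_int :: "'a padic_int" is "\<lambda>_. 0" by simp

lift_definition one_padic_int :: "'a padic_int" is "\<lambda>n. 1 mod int CARD('a) ^ n"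
  by (simp only: padic_mod_Suc_mod)

lift_definition plus_padic_int :: "'a padic_int \<Rightarrow> 'a padic_int \<Rightarrow> 'a padic_int"
  is "\<lambda>x y n. (x n + y n) mod int CARD('a) ^ n"
  by (subst padic_mod_Suc_mod, metis mod_add_eq)

lift_definition minus_padic_int :: "'a padic_int \<Rightarrow> 'a padic_int \<Rightarrow> 'a padic_int"
  is "\<lambda>x y n. (x n - y n) mod int CARD('a) ^ n"
  by (subst padic_mod_Suc_mod, metis mod_diff_eq)

lift_definition uminus_padic_int :: "'a padic_int \<Rightarrow> 'a padic_int"
  is "\<lambda>x n. (- x n) mod int CARD('a) ^ n"
  by (subst padic_mod_Suc_mod, metis mod_minus_eq)

lift_definition times_padic_int :: "'a padic_int \<Rightarrow> 'a padic_int \<Rightarrow> 'a padic_int"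
  is "\<lambda>x y n. (x n * y n) mod int CARD('a) ^ n"
  by (subst padic_mod_Suc_mod, metis mod_mult_eq)

instance
proof
  fix a b c :: "'a padic_int"
  note rep = padic_int_eq_iff plus_padic_int.rep_eq minus_padic_int.rep_eq
    uminus_padic_int.rep_eq times_padic_int.rep_eq zero_padic_int.rep_eq one_padic_int.rep_eq
  show "a * b * c = a * (b * c)"
    by (simp add: rep mod_simps mult.assoc)
  show "a * b = b * a"
    by (simp add: rep mult.commute)
  show "1 * a = a"
    by (simp add: rep mod_simps)
  show "a + b + c = a + (b + c)"
    by (simp add: rep mod_simps add.assoc)
  show "a + b = b + a"
    by (simp add: rep add.commute)
  show "0 + a = a"
    by (simp add: rep)
  show "- a + a = 0"
    by (simp add: rep mod_simps)
  show "a - b = a + - b"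
    by (simp add: rep mod_simps)
  show "(a + b) * c = a * c + b * c"
    by (simp add: rep mod_simps distrib_right)
  have "residue (0 :: 'a padic_int) 1 \<noteq> residue (1 :: 'a padic_int) 1"
    using padic_prime_gt_1[where 'p = 'a]
    by (simp add: zero_padic_int.rep_eq one_padic_int.rep_eq)
  then show "(0 :: 'a padic_int) \<noteq> 1" by metis
qed

end

lemma residue_zero [simp]: "residue 0 n = 0"
  by (simp add: zero_padic_int.rep_eq)

lemma residue_of_nat: "residue (of_nat k :: 'p::prime_card padic_int) n = int k mod int CARD('p) ^ n"
  by (induction k) (auto simp: one_padic_int.rep_eq plus_padic_int.rep_eq mod_simps)

instance padic_int :: (prime_card) idom
proof
  fix a b :: "'a padic_int"
  let ?p = "int CARD('a)"
  assume "a \<noteq> 0" "b \<noteq> 0"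
  then obtain m n where m: "residue a m \<noteq> 0" and n: "residue b n \<noteq> 0"
    by (auto simp: padic_int_eq_iff)
  have a: "\<not> ?p ^ m dvd residue a (m + n)"
    using m residue_mod_le[of m "m + n" a] by (auto simp: dvd_eq_mod_eq_0)
  have b: "\<not> ?p ^ n dvd residue b (m + n)"
    using n residue_mod_le[of n "m + n" b] by (auto simp: dvd_eq_mod_eq_0)
  have pr: "prime_elem ?p"
    using prime_card[where 'a = 'a] by simp
  have "\<not> ?p ^ (m + n) dvd residue a (m + n) * residue b (m + n)"
  proof
    assume "?p ^ (m + n) dvd residue a (m + n) * residue b (m + n)"
    then obtain i j where "i + j = m + n" "?p ^ i dvd residue a (m + n)" "?p ^ j dvd residue b (m + n)"
      using prime_elem_power_dvd_prod[OF _ pr] by blast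
    moreover from \<open>i + j = m + n\<close> have "m \<le> i \<or> n \<le> j" by linarith
    ultimately show False using a b by (meson dvd_trans le_imp_power_dvd)
  qed
  then have "residue (a * b) (m + n) \<noteq> 0"
    by (simp add: times_padic_int.rep_eq dvd_eq_mod_eq_0)
  then show "a * b \<noteq> 0" by (auto simp: padic_int_eq_iff)
qed

instance padic_int :: (prime_card) ring_char_0
proof
  show "inj (of_nat :: nat \<Rightarrow> 'a padic_int)"
  proof (rule injI)
    fix k l :: nat
    assume eq: "(of_nat k :: 'a padic_int) = of_nat l"
    define n where "n = k + l"
    have "n < CARD('a) ^ n"
      using padic_prime_gt_1[where 'p = 'a] by (intro power_gt_expt) simp
    then have "int k < int CARD('a) ^ n" "int l < int CARD('a) ^ n"
      by (simp_all add: n_def flip: of_nat_power)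
    moreover have "int k mod int CARD('a) ^ n = int l mod int CARD('a) ^ n"
      using arg_cong[OF eq, of "\<lambda>x. residue x n"] by (simp add: residue_of_nat)
    ultimately show "k = l" by simp
  qed
qed

lemma padic_power_dvd_iff:
  "of_nat CARD('p) ^ n dvd (x :: 'p::prime_card padic_int) \<longleftrightarrow> residue x n = 0"
proof
  assume "of_nat CARD('p) ^ n dvd x"
  then obtain y where "x = of_nat CARD('p) ^ n * y" by (rule dvdE)
  then have "x = of_nat (CARD('p) ^ n) * y" by (simp only: of_nat_power)
  then have "residue x n = (int (CARD('p) ^ n) mod int CARD('p) ^ n) * residue y n mod int CARD('p) ^ n"
    by (simp only: times_padic_int.rep_eq residue_of_nat)
  then show "residue x n = 0" by (simp only: of_nat_power mod_self mult_zero_left mod_0)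
next
  define q where "q = int CARD('p)"
  have q: "q > 0" by (simp add: q_def)
  assume x: "residue x n = 0"
  define z where "z m = residue x (m + n) div q ^ n" for m
  have z: "residue x (m + n) = q ^ n * z m" for m
  proof -
    have "residue x (m + n) mod q ^ n = 0"
      unfolding q_def using residue_mod_le[of n "m + n" x] x by (simp only: le_add2)
    then show ?thesis unfolding z_def by (metis dvd_eq_mod_eq_0 dvd_mult_div_cancel)
  qed
  have "z m = z (Suc m) mod q ^ m" for m
  proof -
    have "residue x (Suc m + n) mod q ^ (m + n) = residue x (m + n)"
      unfolding q_def add_Suc by (rule residue_Suc_mod)
    then have "q ^ n * z m = (q ^ n * z (Suc m)) mod (q ^ n * q ^ m)"
      by (simp only: z power_add mult.commute[of "q ^ m" "q ^ n"])
    also have "\<dots> = q ^ n * (z (Suc m) mod q ^ m)" by (simp only: mult_mod_right)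
    finally show ?thesis using q by simp
  qed
  then have "z \<in> {x. \<forall>n. x n = x (Suc n) mod int CARD('p) ^ n}"
    unfolding q_def by blast
  then have Abs: "residue (Abs_padic_int z :: 'p padic_int) = z"
    by (rule Abs_padic_int_inverse)
  have "residue x m = residue (of_nat (CARD('p) ^ n) * (Abs_padic_int z :: 'p padic_int)) m" for m
  proof -
    have "residue x m = q ^ n * z m mod q ^ m"
      unfolding z[symmetric] unfolding q_def by (rule residue_mod_le[symmetric]) simp
    also have "\<dots> = (q ^ n mod q ^ m) * z m mod q ^ m" by (simp only: mod_mult_left_eq)
    finally show ?thesis
      by (simp only: times_padic_int.rep_eq residue_of_nat Abs q_def) simp
  qed
  then have "x = of_nat (CARD('p) ^ n) * Abs_padic_int z"
    unfolding padic_int_eq_iff by blast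
  then have "x = of_nat CARD('p) ^ n * Abs_padic_int z" by (simp only: of_nat_power)
  then show "of_nat CARD('p) ^ n dvd x" by (rule dvdI)
qed

definition padic_norm :: "'p::prime_card padic_int \<Rightarrow> real" where
  "padic_norm x =
     (if x = 0 then 0 else (1 / real CARD('p)) ^ (GREATEST n. of_nat CARD('p) ^ n dvd x))"

lemma padic_norm_le_iff:
  "padic_norm (x :: 'p::prime_card padic_int) \<le> (1 / real CARD('p)) ^ n
     \<longleftrightarrow> of_nat CARD('p) ^ n dvd x"
proof (cases "x = 0")
  case False
  define P where "P m \<longleftrightarrow> of_nat CARD('p) ^ m dvd x" for m
  have down: "P i" if "P m" "i \<le> m" for i m
    using that unfolding P_def by (meson dvd_trans le_imp_power_dvd)
  obtain b where "\<not> P b"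
    using False unfolding P_def padic_power_dvd_iff padic_int_eq_iff residue_zero by blast
  then have bound: "m \<le> b" if "P m" for m
    using down[OF that, of b] by (cases "m \<le> b") auto
  have "P 0" by (simp add: P_def)
  then have "P (Greatest P)" and "m \<le> Greatest P" if "P m" for m
    using bound that by (blast intro: GreatestI_nat Greatest_le_nat)+
  then have "P n \<longleftrightarrow> n \<le> Greatest P"
    using \<open>P 0\<close> down by blast
  moreover have "(1 / real CARD('p)) ^ Greatest P \<le> (1 / real CARD('p)) ^ n \<longleftrightarrow> n \<le> Greatest P"
    using padic_prime_gt_1[where 'p = 'p] by (intro power_decreasing_iff) auto
  ultimately show ?thesis
    using False unfolding padic_norm_def P_def by simp
qed (simp add: padic_norm_def)

lemma padic_norm_cases:
  obtains "x = 0" | n where "padic_norm (x :: 'p::prime_card padic_int) = (1 / real CARD('p)) ^ n"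
  using that(1) that(2)[of "GREATEST n. of_nat CARD('p) ^ n dvd x"]
  by (cases "x = 0") (simp_all add: padic_norm_def)

lemma padic_norm_eq_0_iff [simp]: "padic_norm (x :: 'p::prime_card padic_int) = 0 \<longleftrightarrow> x = 0"
  by (simp add: padic_norm_def)

lemma padic_norm_nonneg: "0 \<le> padic_norm (x :: 'p::prime_card padic_int)"
  by (simp add: padic_norm_def)

lemma padic_norm_minus_commute:
  "padic_norm (x - y :: 'p::prime_card padic_int) = padic_norm (y - x)"
proof -
  have "of_nat CARD('p) ^ n dvd x - y \<longleftrightarrow> of_nat CARD('p) ^ n dvd y - x" for n
    by (metis dvd_minus_iff minus_diff_eq)
  then show ?thesis by (auto simp: padic_norm_def)
qed

lemma padic_norm_add_le:
  "padic_norm (x + y :: 'p::prime_card padic_int) \<le> padic_norm x + padic_norm y"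
proof -
  have *: "padic_norm (u + v) \<le> padic_norm v"
    if "padic_norm u \<le> padic_norm v" for u v :: "'p padic_int"
  proof (cases v rule: padic_norm_cases)
    case 1
    then show ?thesis using that padic_norm_nonneg[of u] by simp
  next
    case (2 n)
    then show ?thesis
      using that padic_norm_le_iff[of u n] padic_norm_le_iff[of v n] padic_norm_le_iff[of "u + v" n]
      by simp
  qed
  show ?thesis
    using *[of x y] *[of y x] padic_norm_nonneg[of x] padic_norm_nonneg[of y]
    by (cases "padic_norm x \<le> padic_norm y") (auto simp: add.commute)
qed

instantiation padic_int :: (prime_card) metric_space
begin

definition dist_padic_int :: "'a padic_int \<Rightarrow> 'a padic_int \<Rightarrow> real" where
  "dist_padic_int x y = padic_norm (x - y)"

definition uniformity_padic_int :: "('a padic_int \<times> 'a padic_int) filter" where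
  "uniformity_padic_int = (INF e\<in>{0<..}. principal {(x, y). dist x y < e})"

definition open_padic_int :: "'a padic_int set \<Rightarrow> bool" where
  "open_padic_int U = (\<forall>x\<in>U. eventually (\<lambda>(x', y). x' = x \<longrightarrow> y \<in> U) uniformity)"

instance
proof
  fix x y z :: "'a padic_int"
  show "dist x y = 0 \<longleftrightarrow> x = y"
    by (simp add: dist_padic_int_def)
  show "dist x y \<le> dist x z + dist y z"
    using padic_norm_add_le[of "x - z" "z - y"] padic_norm_minus_commute[of y z]
    by (simp add: dist_padic_int_def)
qed (simp_all add: uniformity_padic_int_def open_padic_int_def)

end

instance fract :: ("{idom,ring_char_0}") field_char_0
proof
  show "inj (of_nat :: nat \<Rightarrow> 'a fract)"
    by (rule injI) (simp add: of_nat_fract eq_fract)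
qed

type_synonym 'p padic = "'p padic_int fract"

definition padic_ideal :: "int \<Rightarrow> 'p::prime_card padic set" where
  "padic_ideal k = range (\<lambda>y. of_nat CARD('p) powi k * to_fract y)"

definition dot :: "nat ^ 'd \<Rightarrow> nat ^ 'd \<Rightarrow> nat" where
  "dot m n = (\<Sum>k\<in>UNIV. m $ k * n $ k)"

definition weight :: "nat ^ 'd \<Rightarrow> nat" where
  "weight n = (\<Sum>k\<in>UNIV. n $ k)"

definition fact_quot :: "(nat ^ 'd) list \<Rightarrow> (nat ^ 'd) list \<Rightarrow> nat ^ 'd \<Rightarrow> rat" where
  "fact_quot e f n = (\<Prod>v\<leftarrow>e. fact (dot v n)) / (\<Prod>v\<leftarrow>f. fact (dot v n))"

lemma finite_weight: "finite {n :: nat ^ 'd. weight n = m}"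
proof (rule finite_subset)
  show "{n :: nat ^ 'd. weight n = m} \<subseteq> vec_lambda ` (UNIV \<rightarrow>\<^sub>E {..m})"
  proof
    fix n :: "nat ^ 'd"
    assume "n \<in> {n. weight n = m}"
    then have "n $ k \<le> m" for k
      unfolding weight_def by (auto intro: member_le_sum)
    then have "vec_nth n \<in> UNIV \<rightarrow>\<^sub>E {..m}" by auto
    then show "n \<in> vec_lambda ` (UNIV \<rightarrow>\<^sub>E {..m})"
      by (intro image_eqI[of _ _ "vec_nth n"]) simp_all
  qed
qed (simp add: finite_PiE)

definition fact_quot_sum :: "(nat ^ 'd) list \<Rightarrow> (nat ^ 'd) list \<Rightarrow> nat \<Rightarrow> rat" where
  "fact_quot_sum e f m = (\<Sum>n | weight n = m. fact_quot e f n)"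

definition fact_quot_sum_weighted ::
    "(nat ^ 'd) list \<Rightarrow> (nat ^ 'd) list \<Rightarrow> (nat ^ 'd \<Rightarrow> 'p::prime_card padic_int) \<Rightarrow> nat \<Rightarrow> 'p padic"
  where "fact_quot_sum_weighted e f g m =
    (\<Sum>n | weight n = m. of_rat (fact_quot e f n) * to_fract (g n))"

definition admissible :: "nat \<Rightarrow> (nat ^ 'd) list \<Rightarrow> bool" where
  "admissible r e \<longleftrightarrow> (\<exists>s\<in>{0..r}.
     (s = 0 \<or> (\<exists>I\<subseteq>{..<length e}. card I = s \<and> (\<forall>i\<in>I. e ! i \<ge> 1))) \<and>
     (s = r \<or> (\<forall>k. \<exists>I\<subseteq>{..<length e}. card I = r - s \<and> (\<forall>i\<in>I. e ! i \<ge> axis k CARD('d)))))"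

text \<open>A polynomial in the variables indexed by \<open>'d\<close> maps exponent vectors to coefficients.\<close>

definition mpoly_fun ::
    "((nat ^ 'd) \<Rightarrow>\<^sub>0 'p::prime_card padic_int) \<Rightarrow> nat ^ 'd \<Rightarrow> 'p padic_int" where
  "mpoly_fun P n =
    (\<Sum>a\<in>Poly_Mapping.keys P. Poly_Mapping.lookup P a * (\<Prod>k\<in>UNIV. of_nat (n $ k) ^ (a $ k)))"

definition poly_limits :: "(nat ^ 'd \<Rightarrow> 'p::prime_card padic_int) set" where
  "poly_limits = {g. \<forall>K. \<exists>P :: nat \<Rightarrow> (nat ^ 'd) \<Rightarrow>\<^sub>0 'p padic_int.
     \<forall>n. (\<forall>k. n $ k \<in> {0..K}) \<longrightarrow> (\<lambda>j. mpoly_fun (P j) n) \<longlonglongrightarrow> g n}"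

text \<open>
  Sequences of \<open>p\<close>-adic integers are given by their values in the fraction field, as quotients of
  factorials are rational by definition and integral only by hypothesis.
\<close>

definition zero_digits :: "(nat \<Rightarrow> 'p::prime_card padic) \<Rightarrow> nat set" where
  "zero_digits A = {v\<in>{0..CARD('p) - 1}. A v \<in> padic_ideal 1}"

text \<open>
  The positions of the base \<open>p\<close> digits of \<open>n\<close>, without leading zeros, are \<open>0\<close> and those \<open>k\<close>
  with \<open>p ^ k \<le> n\<close>.
\<close>

definition zero_digit_count :: "(nat \<Rightarrow> 'p::prime_card padic) \<Rightarrow> nat \<Rightarrow> nat" where
  "zero_digit_count A n =
    card {k. (k = 0 \<or> CARD('p) ^ k \<le> n) \<and> n div CARD('p) ^ k mod CARD('p) \<in> zero_digits A}"

text \<open>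
  A number \<open>q\<close> and polynomials \<open>P 0, \<dots>, P q\<close> represent the operator given by the sum of the
  \<open>z ^ k * P k \<theta>\<close> for \<open>k \<le> q\<close>, where \<open>\<theta> = z * d/dz\<close>.
\<close>

definition theta :: "'a::comm_ring_1 fps \<Rightarrow> 'a fps" where
  "theta F = fps_X * fps_deriv F"

definition poly_theta :: "'p::prime_card padic_int poly \<Rightarrow> 'p padic fps \<Rightarrow> 'p padic fps" where
  "poly_theta P F = (\<Sum>j\<le>degree P. fps_const (to_fract (coeff P j)) * (theta ^^ j) F)"

definition diff_op ::
    "nat \<Rightarrow> (nat \<Rightarrow> 'p::prime_card padic_int poly) \<Rightarrow> 'p padic fps \<Rightarrow> 'p padic fps" where
  "diff_op q P F = (\<Sum>k\<le>q. fps_X ^ k * poly_theta (P k) F)"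

definition unit_preserving :: "'a::comm_ring_1 poly \<Rightarrow> bool" where
  "unit_preserving P \<longleftrightarrow> poly P ` {x. x dvd 1} \<subseteq> {x. x dvd 1}"

definition type_I :: "nat \<Rightarrow> (nat \<Rightarrow> 'p::prime_card padic_int poly) \<Rightarrow> bool" where
  "type_I q P \<longleftrightarrow> unit_preserving (P 0) \<and>
     (\<forall>k\<in>{2..q}. (\<Prod>i=1..k - 1. [:of_nat i, 1:]\<^sup>2) dvd P k)"

definition type_II :: "nat \<Rightarrow> (nat \<Rightarrow> 'p::prime_card padic_int poly) \<Rightarrow> bool" where
  "type_II q P \<longleftrightarrow> q = 2 \<and> unit_preserving (P 0) \<and> [:1, 1:] dvd P 2"

end

theory Submission
  imports Defs "HOL-Number_Theory.Modular_Inverse"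
begin

text \<open>
  Each \<open>\<Q>(n)\<close> is a product of multinomial coefficients.  Let \<open>s\<close> be the sequence of their sums and
  \<open>\<alpha>(n)\<close> the number of digits of \<open>n\<close> in \<open>\<Z>\<close>.  Instead of limits of polynomials, work with the larger
  class of 1-Lipschitz weights \<open>g\<close>, and show by simultaneous strong induction that
  \<open>p ^ \<alpha>(n)\<close> divides \<open>s n\<close> and that \<open>p ^ \<alpha>(n div p)\<close> divides the sum weighted by \<open>g\<close>.

  The ratio \<open>\<Q>(a + p k) / \<Q>(k)\<close> is a 1-Lipschitz function of \<open>p k\<close>, and is divisible by
  \<open>p ^ j\<close> if \<open>a\<close> has weight at least \<open>p j\<close>; this reduces weighted sums at \<open>v + p m\<close> to weighted sums at
  \<open>m - j\<close>.  The second claim follows, since a borrow \<open>m - j\<close> loses at most \<open>j\<close> digits.  For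
  the first claim, the type of the operator makes the recurrence for \<open>s\<close> decouple between blocks of
  \<open>p\<close> consecutive indices, so that \<open>s (v + p m) \<equiv> s v * s (p m)\<close> modulo \<open>p ^ (\<alpha>(m) + 1)\<close>.
\<close>

section \<open>Counting digits in a set, and the loss under subtraction\<close>

text \<open>Leading zeros are positions too. When \<open>0\<close> is not in \<open>Z\<close> they
  contribute nothing, and the recursion in \<open>n div p\<close> needs no case for the top
  digit.\<close>

definition digit_count :: "nat \<Rightarrow> nat set \<Rightarrow> nat \<Rightarrow> nat" where
  "digit_count p Z n = card {k. n div p ^ k mod p \<in> Z}"

lemma finite_digit_positions:
  fixes n p :: nat
  assumes "1 < p" "0 \<notin> Z"
  shows "finite {k. n div p ^ k mod p \<in> Z}"
proof (rule finite_subset)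
  show "{k. n div p ^ k mod p \<in> Z} \<subseteq> {..n}"
  proof (rule subsetI, rule ccontr)
    fix k assume k: "k \<in> {k. n div p ^ k mod p \<in> Z}" "k \<notin> {..n}"
    have "k < p ^ k" using assms(1) by (simp add: power_gt_expt)
    with k have "n div p ^ k = 0" by simp
    with k assms show False by simp
  qed
qed simp

lemma digit_count_0: "0 \<notin> Z \<Longrightarrow> digit_count p Z 0 = 0"
  by (simp add: digit_count_def)

lemma digit_count_div:
  assumes "1 < p" "0 \<notin> Z"
  shows "digit_count p Z n = digit_count p Z (n div p) + (if n mod p \<in> Z then 1 else 0)"
proof -
  have Suc: "n div p ^ Suc k mod p = n div p div p ^ k mod p" for k
    by (simp add: div_mult2_eq)
  have "{k. n div p ^ k mod p \<in> Z}
      = (if n mod p \<in> Z then {0} else {}) \<union> Suc ` {k. n div p div p ^ k mod p \<in> Z}"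
    (is "?L = ?A \<union> ?B")
  proof (rule set_eqI)
    fix k show "k \<in> ?L \<longleftrightarrow> k \<in> ?A \<union> ?B"
      by (cases k) (auto simp: Suc simp del: power_Suc)
  qed
  moreover have "card (?A \<union> ?B) = card ?A + card ?B"
    using assms by (intro card_Un_disjoint) (auto simp: finite_digit_positions)
  moreover have "card ?B = digit_count p Z (n div p)"
    by (simp add: digit_count_def card_image)
  ultimately show ?thesis by (simp add: digit_count_def)
qed

text \<open>Either only the last digit changes, or it turns into 0, which is not in
  \<open>Z\<close>, and the carry poses the same question for \<open>n div p\<close>.\<close>

lemma digit_count_Suc:
  assumes "1 < p" "0 \<notin> Z"
  shows "digit_count p Z (Suc n) \<le> Suc (digit_count p Z n)"
proof (induction n rule: less_induct)
  case (less n)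
  note rec = digit_count_div[OF assms]
  show ?case
  proof (cases "Suc n mod p = 0")
    case False
    then have "Suc n div p = n div p" by (simp add: div_Suc)
    then show ?thesis using rec[of n] rec[of "Suc n"] by simp
  next
    case True
    then have d: "Suc n div p = Suc (n div p)" by (simp add: div_Suc)
    show ?thesis
    proof (cases "n = 0")
      case True
      then show ?thesis using \<open>Suc n mod p = 0\<close> assms by (simp add: mod_Suc)
    next
      case False
      then have "n div p < n" using assms by simp
      with less[of "n div p"] show ?thesis
        using rec[of n] rec[of "Suc n"] d True assms by simp
    qed
  qed
qed

lemma digit_count_add:
  assumes "1 < p" "0 \<notin> Z"
  shows "digit_count p Z (n + t) \<le> digit_count p Z n + t"
proof (induction t)
  case (Suc t)
  then show ?case using digit_count_Suc[OF assms, of "n + t"] by simp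
qed simp

text \<open>The quotients \<open>m div p\<close> and \<open>(m - j) div p\<close> differ by some
  \<open>t\<close>, and each unit of \<open>t\<close> loses at most one counted digit. The last
  digit of \<open>m\<close> may count once more, so \<open>t\<close> plus this digit's count has to
  be at most \<open>j\<close>.\<close>

lemma digit_count_diff_div:
  assumes p: "1 < p" "0 \<notin> Z" and j: "1 \<le> j" "j \<le> m"
  shows "digit_count p Z m \<le> digit_count p Z ((m - j) div p) + j"
proof -
  define t where "t = m div p - (m - j) div p"
  have le: "(m - j) div p \<le> m div p" by (simp add: div_le_mono)
  have mt: "m div p = (m - j) div p + t" using le by (simp add: t_def)
  \<comment> \<open>If \<open>t = 0\<close>, then \<open>j \<ge> 1\<close> suffices. Otherwise
    \<open>p * t + m mod p \<le> j + (p - 1)\<close> gives \<open>t + m mod p \<le> j\<close>, and a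
    last digit in \<open>Z\<close> is at least 1.\<close>
  have "t + (if m mod p \<in> Z then 1 else 0) \<le> j"
  proof (cases "t = 0")
    case True
    then show ?thesis using j by simp
  next
    case False
    have "m = p * ((m - j) div p) + p * t + m mod p"
      by (metis mt add_mult_distrib2 mult_div_mod_eq)
    moreover have "m - j = p * ((m - j) div p) + (m - j) mod p"
      by simp
    moreover have "(m - j) mod p \<le> p - 1" using p by (simp add: less_Suc_eq_le[symmetric])
    ultimately have "p * t + m mod p \<le> j + (p - 1)" using j by linarith
    moreover have "p * t = p + p * (t - 1)" using False by (cases t) auto
    moreover have "t - 1 \<le> p * (t - 1)" using p by simp
    ultimately have "t + m mod p \<le> j" using p False by linarith
    moreover have "m mod p \<in> Z \<Longrightarrow> m mod p \<ge> 1" using p by (cases "m mod p") auto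
    ultimately show ?thesis by auto
  qed
  with digit_count_div[OF p, of m] digit_count_add[OF p, of "(m - j) div p" t] mt
  show ?thesis by (simp split: if_splits)
qed

section \<open>Lipschitz functions with p-adic integer values\<close>

abbreviation uniformizer :: "'p::prime_card padic_int" (\<open>\<pi>\<close>) where
  "\<pi> \<equiv> of_nat CARD('p)"

text \<open>The inverses of \<open>n\<close> modulo the powers of p are compatible, because a
  modular inverse is unique in its range; so they form a point of the inverse limit.\<close>

lemma of_nat_dvd_one_padic_int:
  assumes "coprime n CARD('p)"
  shows "(of_nat n :: 'p::prime_card padic_int) dvd 1"
proof -
  define q where "q = int CARD('p)"
  define y where "y k = modular_inverse (q ^ k) (int n)" for k
  have q: "q ^ k > 0" for k by (simp add: q_def)
  have cop: "coprime (int n) (q ^ k)" for k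
    using assms by (simp add: q_def)
  have inv: "[int n * y k = 1] (mod q ^ k)" for k
    unfolding y_def by (rule cong_modular_inverse1) (rule cop)
  have y: "y k = y (Suc k) mod q ^ k" for k
    unfolding y_def[of k]
  proof (rule modular_inverse_int_eqI)
    show "y (Suc k) mod q ^ k \<in> {0..<q ^ k}" using q by simp
    have "[int n * y (Suc k) = 1] (mod q ^ k)"
      using inv[of "Suc k"] by (rule cong_dvd_modulus) simp
    then show "[int n * (y (Suc k) mod q ^ k) = 1] (mod q ^ k)"
      by (simp add: cong_def mod_mult_right_eq)
  qed
  then have "y \<in> {x. \<forall>n. x n = x (Suc n) mod int CARD('p) ^ n}"
    unfolding q_def by blast
  then have "residue (Abs_padic_int y :: 'p padic_int) = y"
    by (rule Abs_padic_int_inverse)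
  then have "of_nat n * Abs_padic_int y = (1 :: 'p padic_int)"
    using inv unfolding padic_int_eq_iff
    by (simp add: times_padic_int.rep_eq residue_of_nat one_padic_int.rep_eq cong_def mod_simps q_def)
  then show ?thesis by (metis dvd_triv_left)
qed

lemma of_nat_dvd_padic_int_iff:
  "\<pi> ^ k dvd (of_nat n :: 'p::prime_card padic_int) \<longleftrightarrow> CARD('p) ^ k dvd n"
  unfolding padic_power_dvd_iff residue_of_nat
  by (metis dvd_eq_mod_eq_0 of_nat_dvd_iff of_nat_power)

lemma unit_dvd_cancel:
  fixes x u d :: "'a::comm_ring_1"
  assumes "u dvd 1" "d dvd u * x"
  shows "d dvd x"
proof -
  obtain w where w: "1 = u * w" using assms(1) by (rule dvdE)
  have "x = (u * w) * x" by (simp flip: w)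
  then have "x = (u * x) * w" by (simp add: ac_simps)
  with assms(2) show ?thesis by (metis dvd_mult2)
qed

text \<open>The bound \<open>\<bar>g x - g y\<bar> \<le> p ^ -s * \<bar>x - y\<bar>\<close> for the \<open>p\<close>-adic absolute values.\<close>

definition lip :: "nat \<Rightarrow> (nat ^ 'd \<Rightarrow> 'p::prime_card padic_int) \<Rightarrow> bool" where
  "lip s g \<longleftrightarrow> (\<forall>l n m. \<pi> ^ (l + s) dvd g (n + CARD('p) ^ l *s m) - g n)"

lemma lip_const [simp]: "lip s (\<lambda>_. c)"
  by (simp add: lip_def)

lemma lip_mono: "lip s g \<Longrightarrow> r \<le> s \<Longrightarrow> lip r g"
  unfolding lip_def by (meson add_left_mono dvd_trans le_imp_power_dvd)

lemma dvd_mult_diff_mult: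
  fixes d :: "'a::comm_ring_1"
  assumes "d dvd x - x'" "d dvd y - y'"
  shows "d dvd x * y - x' * y'"
proof -
  have "x * y - x' * y' = (x - x') * y + x' * (y - y')" by (simp add: algebra_simps)
  with assms show ?thesis by simp
qed

lemma dvd_power_diff_power:
  fixes d :: "'a::comm_ring_1"
  assumes "d dvd x - x'"
  shows "d dvd x ^ k - x' ^ k"
  by (induction k) (auto intro!: dvd_mult_diff_mult assms)

lemma dvd_prod_diff_prod:
  fixes d :: "'a::comm_ring_1"
  assumes "\<And>i. i \<in> A \<Longrightarrow> d dvd f i - g i"
  shows "d dvd prod f A - prod g A"
  using assms by (induction A rule: infinite_finite_induct) (auto intro!: dvd_mult_diff_mult)

lemma lip_mult: "lip s g \<Longrightarrow> lip s h \<Longrightarrow> lip s (\<lambda>n. g n * h n)"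
  unfolding lip_def by (blast intro: dvd_mult_diff_mult)

lemma lip_power: "lip s g \<Longrightarrow> lip s (\<lambda>n. g n ^ k)"
  by (induction k) (auto intro: lip_mult)

lemma lip_prod: "(\<And>i. i \<in> A \<Longrightarrow> lip s (g i)) \<Longrightarrow> lip s (\<lambda>n. \<Prod>i\<in>A. g i n)"
  by (induction A rule: infinite_finite_induct) (auto intro: lip_mult)

text \<open>Quotient rule for differences: the increment of \<open>q\<close>, times the unit
  \<open>h n\<close>, is a combination of the increments of \<open>g\<close> and
  \<open>h\<close>.\<close>

lemma lip_quotient:
  fixes g h q :: "nat ^ 'd \<Rightarrow> 'p::prime_card padic_int"
  assumes "lip s g" "lip s h" and unit: "\<And>n. h n dvd 1" and q: "\<And>n. h n * q n = g n"
  shows "lip s q"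
  unfolding lip_def
proof (intro allI)
  fix l and n m :: "nat ^ 'd"
  let ?n = "n + CARD('p) ^ l *s m" and ?d = "\<pi> ^ (l + s) :: 'p padic_int"
  have "h n * (q ?n - q n) = (g ?n - g n) - (h ?n - h n) * q ?n"
    by (simp add: algebra_simps flip: q)
  moreover have "?d dvd g ?n - g n" "?d dvd h ?n - h n" using assms by (auto simp: lip_def)
  ultimately have "?d dvd h n * (q ?n - q n)" by simp
  then show "?d dvd q ?n - q n" by (rule unit_dvd_cancel[OF unit])
qed

text \<open>A step of \<open>p ^ l\<close> in \<open>k\<close> is a step of
  \<open>p ^ (l + 1)\<close> in the argument of \<open>g\<close>, which gains one exponent.\<close>

lemma lip_shift:
  fixes g :: "nat ^ 'd \<Rightarrow> 'p::prime_card padic_int"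
  assumes "lip s g"
  shows "lip (Suc s) (\<lambda>k. g (a + CARD('p) *s k))"
  unfolding lip_def
proof (intro allI)
  fix l n m
  have eq: "a + CARD('p) *s (n + CARD('p) ^ l *s m) = (a + CARD('p) *s n) + CARD('p) ^ Suc l *s m"
    by (simp add: vec_eq_iff algebra_simps)
  show "\<pi> ^ (l + Suc s) dvd
      g (a + CARD('p) *s (n + CARD('p) ^ l *s m)) - g (a + CARD('p) *s n)"
    using assms unfolding lip_def eq add_Suc_right add_Suc[symmetric] by blast
qed

text \<open>The bound at \<open>l = 0\<close> makes \<open>g\<close> constant modulo \<pi>. For
  \<open>s = 0\<close> this splits a weight into a constant, to which the first claim of the
  induction applies, and \<pi> times a 1-Lipschitz weight, to which the second applies.\<close>

lemma lip_Suc_decompose: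
  fixes g :: "nat ^ 'd \<Rightarrow> 'p::prime_card padic_int"
  assumes "lip (Suc s) g"
  obtains h where "lip s h" "\<And>n. g n = g 0 + \<pi> * h n"
proof -
  have "\<exists>y. g n = g 0 + \<pi> * y" for n
  proof -
    have "\<pi> ^ (0 + Suc s) dvd g (0 + CARD('p) ^ 0 *s n) - g 0"
      using assms unfolding lip_def by blast
    then have "\<pi> dvd g n - g 0"
      by (simp add: vec_eq_iff dvd_mult_left vector_scalar_mult_def)
    then show ?thesis by (metis dvdE add.commute diff_add_cancel)
  qed
  then obtain h where h: "\<And>n. g n = g 0 + \<pi> * h n" by metis
  have "lip s h"
    unfolding lip_def
  proof (intro allI)
    fix l and n m :: "nat ^ 'd"
    let ?n = "n + CARD('p) ^ l *s m"
    have "\<pi> ^ (l + Suc s) dvd g ?n - g n" using assms by (simp add: lip_def)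
    moreover have "g ?n - g n = \<pi> * (h ?n - h n)"
      by (subst h, subst (2) h) (simp add: algebra_simps)
    ultimately show "\<pi> ^ (l + s) dvd h ?n - h n" using padic_prime_pos[where 'p = 'p] by auto
  qed
  with h that show ?thesis by blast
qed

lemma lip_of_nat_affine:
  fixes f :: "nat ^ 'd \<Rightarrow> nat"
  assumes "\<And>n m. f (n + m) = f n + f m" "\<And>t n. f (t *s n) = t * f n"
  shows "lip 0 (\<lambda>n. of_nat (f n + r) :: 'p::prime_card padic_int)"
    and "lip 1 (\<lambda>n. of_nat (CARD('p) * f n + r) :: 'p padic_int)"
  using assms by (simp_all add: lip_def algebra_simps)

lemma lip_mpoly_fun: "lip 0 (mpoly_fun P)"
  unfolding lip_def mpoly_fun_def sum_subtractf[symmetric]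
  by (intro allI dvd_sum)
    (auto simp: right_diff_distrib[symmetric] intro!: dvd_mult dvd_prod_diff_prod dvd_power_diff_power)

text \<open>Polynomials with integral coefficients respect congruences, and a congruence between the
  values at two points survives pointwise limits.\<close>

lemma lip_poly_limits:
  fixes g :: "nat ^ 'd \<Rightarrow> 'p::prime_card padic_int"
  assumes "g \<in> poly_limits"
  shows "lip 0 g"
  unfolding lip_def
proof (intro allI)
  fix l and n m :: "nat ^ 'd"
  define n' where "n' = n + CARD('p) ^ l *s m"
  \<comment> \<open>\<open>K\<close> bounds the coordinates of both points, so one sequence of
    polynomials converges at both and one index \<open>j\<close> is close enough at both.\<close>
  define K where "K = Max (range (\<lambda>k. n' $ k))"
  have K: "n' $ k \<le> K" for k by (simp add: K_def)
  have "n $ k \<le> n' $ k" for k by (simp add: n'_def)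
  then have K': "n $ k \<le> K" for k using K by (meson le_trans)
  obtain P :: "nat \<Rightarrow> (nat ^ 'd) \<Rightarrow>\<^sub>0 'p padic_int"
    where P: "\<And>n. (\<forall>k. n $ k \<in> {0..K}) \<Longrightarrow> (\<lambda>j. mpoly_fun (P j) n) \<longlonglongrightarrow> g n"
    using assms unfolding poly_limits_def by blast
  have "(1 / real CARD('p)) ^ l > 0" by simp
  then have "eventually (\<lambda>j. dist (mpoly_fun (P j) n) (g n) < (1 / real CARD('p)) ^ l \<and>
     dist (mpoly_fun (P j) n') (g n') < (1 / real CARD('p)) ^ l) sequentially"
    using P[of n] P[of n'] K K' by (intro eventually_conj tendstoD) auto
  then obtain j where "dist (mpoly_fun (P j) n) (g n) < (1 / real CARD('p)) ^ l"
    "dist (mpoly_fun (P j) n') (g n') < (1 / real CARD('p)) ^ l"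
    by (auto dest: eventually_happens)
  then have d: "\<pi> ^ l dvd mpoly_fun (P j) n - g n" "\<pi> ^ l dvd mpoly_fun (P j) n' - g n'"
    unfolding dist_padic_int_def padic_norm_le_iff[symmetric] by simp_all
  have "\<pi> ^ l dvd mpoly_fun (P j) n' - mpoly_fun (P j) n"
    using lip_mpoly_fun[of "P j"] unfolding lip_def n'_def by (metis add_0_right)
  from dvd_add[OF dvd_diff[OF this d(2)] d(1)]
  show "\<pi> ^ (l + 0) dvd g n' - g n" by (simp add: algebra_simps)
qed

section \<open>Multinomial coefficients modulo powers of the prime\<close>

definition fact_prod :: "nat ^ 'd \<Rightarrow> nat ^ 'd \<Rightarrow> nat" where
  "fact_prod c n = (\<Prod>k\<in>UNIV. fact (n $ k) ^ (c $ k))"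

text \<open>The multinomial coefficient for splitting \<open>dot c n\<close> objects into classes,
  \<open>c $ k\<close> of them of size \<open>n $ k\<close> for each \<open>k\<close>. The division
  is exact by \<open>fact_prod_dvd\<close>.\<close>

definition multinom :: "nat ^ 'd \<Rightarrow> nat ^ 'd \<Rightarrow> nat" where
  "multinom c n = fact (dot c n) div fact_prod c n"

definition multinom_prod :: "(nat ^ 'd) list \<Rightarrow> nat ^ 'd \<Rightarrow> nat" where
  "multinom_prod e n = (\<Prod>c\<leftarrow>e. multinom c n)"

lemma fact_power_dvd_fact_mult: "(fact m ^ k :: nat) dvd fact (k * m)"
proof (induction k)
  case (Suc k)
  then have "(fact m * fact m ^ k :: nat) dvd fact m * fact (k * m)" by simp
  also have "\<dots> dvd fact (m + k * m)" by (rule fact_fact_dvd_fact)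
  finally show ?case by simp
qed simp

lemma fact_prod_dvd: "fact_prod c n dvd fact (dot c n)"
proof -
  have "(\<Prod>k\<in>A. fact (n $ k) ^ (c $ k) :: nat) dvd fact (\<Sum>k\<in>A. c $ k * n $ k)" if "finite A" for A
    using that
  proof induction
    case (insert k A)
    then have "(\<Prod>k\<in>insert k A. fact (n $ k) ^ (c $ k) :: nat)
        dvd fact (c $ k * n $ k) * fact (\<Sum>k\<in>A. c $ k * n $ k)"
      by (simp add: mult_dvd_mono fact_power_dvd_fact_mult)
    also have "\<dots> dvd fact (c $ k * n $ k + (\<Sum>k\<in>A. c $ k * n $ k))" by (rule fact_fact_dvd_fact)
    finally show ?case using insert by simp
  qed simp
  then show ?thesis by (simp add: fact_prod_def dot_def)
qed

lemma fact_prod_pos: "fact_prod c n > 0"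
  by (simp add: fact_prod_def prod_pos)

lemma multinom_mult: "multinom c n * fact_prod c n = fact (dot c n)"
  unfolding multinom_def by (rule dvd_div_mult_self[OF fact_prod_dvd])

lemma multinom_0 [simp]: "multinom c 0 = 1"
  by (simp add: multinom_def fact_prod_def dot_def)

lemma multinom_prod_0 [simp]: "multinom_prod e 0 = 1"
  by (induction e) (simp_all add: multinom_prod_def)

lemma fact_prod_sum_list: "fact_prod (sum_list e) n = (\<Prod>c\<leftarrow>e. fact_prod c n)"
  by (induction e) (simp_all add: fact_prod_def power_add prod.distrib)

lemma fact_prod_axis: "fact_prod (axis k 1) n = fact (n $ k)"
proof -
  have "fact_prod (axis k 1) n = (\<Prod>i\<in>UNIV. if k = i then fact (n $ i) else 1)"
    unfolding fact_prod_def by (rule prod.cong) (auto simp: axis_def)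
  then show ?thesis by simp
qed

lemma dot_axis: "dot (axis k 1) n = n $ k"
proof -
  have "dot (axis k 1) n = (\<Sum>i\<in>UNIV. if k = i then n $ i else 0)"
    unfolding dot_def by (rule sum.cong) (auto simp: axis_def)
  then show ?thesis by simp
qed

text \<open>As \<open>f\<close> consists of unit vectors, its denominator is
  \<open>fact_prod (sum_list f) n\<close>. With \<open>sum_list e = sum_list f\<close> it splits
  into one factor below each factorial of the numerator.\<close>

lemma fact_quot_eq_multinom_prod:
  assumes "f = map (\<lambda>k. axis k 1) ks" and eq: "sum_list e = sum_list f"
  shows "fact_quot e f n = of_nat (multinom_prod e n)"
proof -
  have f: "(\<Prod>v\<leftarrow>f. fact (dot v n)) = fact_prod (sum_list f) n"
    unfolding fact_prod_sum_list assms(1)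
    by (simp only: map_map comp_def fact_prod_axis dot_axis)
  have e: "(\<Prod>v\<leftarrow>e. fact (dot v n)) = multinom_prod e n * fact_prod (sum_list e) n"
    unfolding fact_prod_sum_list multinom_prod_def
    by (induction e) (simp_all flip: multinom_mult)
  have cast: "(\<Prod>v\<leftarrow>xs. fact (dot v n)) = (of_nat (\<Prod>v\<leftarrow>xs. fact (dot v n)) :: rat)" for xs
    by (induction xs) simp_all
  show ?thesis
    unfolding fact_quot_def cast f e eq using fact_prod_pos[of "sum_list f" n] by simp
qed

section \<open>Multinomial coefficients at \<open>a + p *s k\<close> compared with those at
  \<open>k\<close>\<close>

lemma dot_add: "dot c (n + m) = dot c n + dot c m"
  by (simp add: dot_def algebra_simps sum.distrib)

lemma dot_scale: "dot c (t *s n) = t * dot c n"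
  by (simp add: dot_def sum_distrib_left ac_simps)

text \<open>The part of \<open>(p * n)!\<close> that is prime to \<open>p\<close>.\<close>

definition prime_to_fact :: "nat \<Rightarrow> nat \<Rightarrow> nat" where
  "prime_to_fact p n = (\<Prod>i<n. \<Prod>r\<in>{1..<p}. p * i + r)"

lemma fact_add_eq_prod: "fact (m + n) = fact m * (\<Prod>r\<in>{1..n}. m + r)" for m n :: nat
  by (induction n) (simp_all add: algebra_simps)

text \<open>The block \<open>p * i + 1, ..., p * i + p\<close> consists of the prime-to-p factors
  and the one multiple \<open>p * (i + 1)\<close>.\<close>

lemma fact_mult_prime:
  assumes "p > 0"
  shows "fact (p * n) = (p ^ n * fact n * prime_to_fact p n :: nat)"
proof (induction n)
  case (Suc n)
  define W where "W = (\<Prod>r\<in>{1..<p}. p * n + r)"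
  have U: "prime_to_fact p (Suc n) = prime_to_fact p n * W" by (simp add: prime_to_fact_def W_def)
  have "{1..p} = insert p {1..<p}" using assms by auto
  then have "(\<Prod>r\<in>{1..p}. p * n + r) = p * Suc n * W"
    by (simp add: W_def algebra_simps)
  then have "fact (p * Suc n) = fact (p * n) * (p * Suc n * W)"
    by (simp only: fact_add_eq_prod mult_Suc_right add.commute[of p])
  also have "\<dots> = p ^ Suc n * fact (Suc n) * prime_to_fact p (Suc n)"
    unfolding Suc U by (simp add: algebra_simps)
  finally show ?case .
qed (simp add: prime_to_fact_def)

lemma coprime_mult_add:
  fixes p :: nat
  assumes "prime p" "0 < r" "r < p"
  shows "coprime (p * i + r) p"
proof -
  have "\<not> p dvd r" using assms by (auto dest: dvd_imp_le)
  then have "\<not> p dvd p * i + r" by (simp add: dvd_add_right_iff)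
  then show ?thesis using assms(1) by (metis coprime_commute prime_imp_coprime)
qed

lemma coprime_prime_to_fact: "prime p \<Longrightarrow> coprime (prime_to_fact p n) p"
  unfolding prime_to_fact_def by (intro prod_coprime_left coprime_mult_add) auto

text \<open>
  Generalised Wilson: \<open>prime_to_fact p (p ^ l)\<close> is the product of a reduced residue system
  modulo \<open>p ^ (l + 1)\<close>.  Its value, which has the exceptional sign for \<open>p = 2\<close>, never matters.
\<close>

lemma prime_to_fact_add_power:
  "\<pi> ^ Suc l dvd (of_nat (prime_to_fact CARD('p) (n + CARD('p) ^ l * t)) :: 'p::prime_card padic_int)
     - of_nat (prime_to_fact CARD('p) n) * of_nat (prime_to_fact CARD('p) (CARD('p) ^ l)) ^ t"
proof (induction t)
  case (Suc t)
  let ?U = "\<lambda>n. of_nat (prime_to_fact CARD('p) n) :: 'p padic_int" and ?q = "CARD('p) ^ l"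
  \<comment> \<open>Raising \<open>i\<close> by \<open>p ^ l\<close> changes each factor
    \<open>p * i + r\<close> by a multiple of \<open>p ^ (l + 1)\<close>, so the factors appended on
    the two sides agree modulo that power.\<close>
  have step: "\<pi> ^ Suc l dvd ?U (m + ?q) - ?U m * ?U ?q" for m
  proof (induction m)
    case (Suc m)
    let ?W = "\<lambda>i. of_nat (\<Prod>r\<in>{1..<CARD('p)}. CARD('p) * i + r) :: 'p padic_int"
    have "\<pi> ^ Suc l dvd ?W (m + ?q) - ?W m"
      unfolding of_nat_prod by (rule dvd_prod_diff_prod) (simp add: algebra_simps)
    then have "\<pi> ^ Suc l dvd ?U (m + ?q) * ?W (m + ?q) - ?U m * ?U ?q * ?W m"
      by (rule dvd_mult_diff_mult[OF Suc])
    moreover have "?U (Suc i) = ?U i * ?W i" for i by (simp add: prime_to_fact_def)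
    ultimately show ?case by (simp add: ac_simps)
  qed (simp add: prime_to_fact_def)
  have "\<pi> ^ Suc l dvd ?U (n + ?q * t) * ?U ?q - ?U n * ?U ?q ^ t * ?U ?q"
    by (rule dvd_mult_diff_mult[OF Suc]) simp
  from dvd_add[OF step[of "n + ?q * t"] this] show ?case
    by (simp add: algebra_simps)
qed (simp add: prime_to_fact_def)

lemma ex_unit_quotient:
  fixes u :: "'a::comm_ring_1"
  assumes "u dvd 1"
  shows "\<exists>q. u * q = g"
  using assms by (metis dvdE mult.assoc mult_1)

text \<open>Modulo \<open>\<pi> ^ (l + 1)\<close>, a shift by \<open>p ^ l *s m\<close> multiplies
  numerator and denominator by the same unit \<open>\<epsilon> ^ dot c m\<close>, which
  cancels.\<close>

lemma lip_prime_to_fact_quotient: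
  fixes c :: "nat ^ 'd" and \<rho> :: "nat ^ 'd \<Rightarrow> 'p::prime_card padic_int"
  assumes \<rho>: "\<And>n. of_nat (\<Prod>k\<in>UNIV. prime_to_fact CARD('p) (n $ k) ^ (c $ k)) * \<rho> n
      = of_nat (prime_to_fact CARD('p) (dot c n))"
  shows "lip 1 \<rho>"
  unfolding lip_def
proof (intro allI)
  fix l and n m :: "nat ^ 'd"
  let ?U = "\<lambda>n. of_nat (prime_to_fact CARD('p) n) :: 'p padic_int" and ?n = "n + CARD('p) ^ l *s m"
  define \<epsilon> where "\<epsilon> = ?U (CARD('p) ^ l)"
  define V where "V n = (\<Prod>k\<in>UNIV. ?U (n $ k) ^ (c $ k))" for n :: "nat ^ 'd"
  have \<rho>': "V n * \<rho> n = ?U (dot c n)" for n using \<rho>[of n] by (simp add: V_def)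
  have U: "\<pi> ^ Suc l dvd ?U (i + CARD('p) ^ l * t) - ?U i * \<epsilon> ^ t" for i t
    unfolding \<epsilon>_def by (rule prime_to_fact_add_power)
  have "\<pi> ^ Suc l dvd V ?n - (\<Prod>k\<in>UNIV. (?U (n $ k) * \<epsilon> ^ (m $ k)) ^ (c $ k))"
    unfolding V_def using U by (auto intro!: dvd_prod_diff_prod dvd_power_diff_power)
  also have "(\<Prod>k\<in>UNIV. (?U (n $ k) * \<epsilon> ^ (m $ k)) ^ (c $ k)) = V n * \<epsilon> ^ dot c m"
    by (simp add: V_def dot_def power_sum power_mult_distrib prod.distrib mult.commute flip: power_mult)
  finally have V: "\<pi> ^ Suc l dvd V ?n - V n * \<epsilon> ^ dot c m" .
  have "(V n * \<epsilon> ^ dot c m) * (\<rho> ?n - \<rho> n)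
      = (V ?n * \<rho> ?n - V n * \<rho> n * \<epsilon> ^ dot c m) - (V ?n - V n * \<epsilon> ^ dot c m) * \<rho> ?n"
    by (simp add: algebra_simps)
  moreover have "\<pi> ^ Suc l dvd V ?n * \<rho> ?n - V n * \<rho> n * \<epsilon> ^ dot c m"
    using U[of "dot c n" "dot c m"] by (simp only: \<rho>' dot_add dot_scale)
  ultimately have "\<pi> ^ Suc l dvd (V n * \<epsilon> ^ dot c m) * (\<rho> ?n - \<rho> n)" using V by simp
  moreover have "V n * \<epsilon> ^ dot c m dvd 1"
  proof -
    have "V n * \<epsilon> ^ dot c m = of_nat ((\<Prod>k\<in>UNIV. prime_to_fact CARD('p) (n $ k) ^ (c $ k))
        * prime_to_fact CARD('p) (CARD('p) ^ l) ^ dot c m)"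
      by (simp add: V_def \<epsilon>_def)
    also have "\<dots> dvd (1 :: 'p padic_int)"
      using coprime_prime_to_fact[OF prime_card[where 'a = 'p]]
      by (intro of_nat_dvd_one_padic_int) (simp add: prod_coprime_left)
    finally show ?thesis .
  qed
  ultimately show "\<pi> ^ (l + 1) dvd \<rho> ?n - \<rho> n" by (metis unit_dvd_cancel Suc_eq_plus1)
qed

text \<open>Both forms of the ratio are needed: \<open>G\<close> has the sharper Lipschitz bound and
  serves the residue vectors of weight below p; \<open>H\<close> gives up one exponent in exchange
  for the explicit power of \<pi>, which counts the multiples of p up to
  \<open>dot c a\<close>.\<close>

lemma multinom_shift:
  fixes a c :: "nat ^ 'd"
  assumes a: "\<And>k. a $ k < CARD('p::prime_card)"
  obtains G H :: "nat ^ 'd \<Rightarrow> 'p::prime_card padic_int" where "lip 1 G" "lip 0 H"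
    "\<And>k. of_nat (multinom c (a + CARD('p) *s k)) = of_nat (multinom c k) * G k"
    "\<And>k. G k = \<pi> ^ (dot c a div CARD('p)) * H k"
proof -
  let ?p = "CARD('p)"
  let ?U = "prime_to_fact ?p"
  have p: "prime ?p" "?p > 0" using prime_card[where 'a = 'p] by auto
  \<comment> \<open>\<open>R\<close> collects the numerator's factors beyond
    \<open>fact (p * dot c k)\<close>, \<open>E\<close> those of the denominator beyond
    \<open>fact (p * k $ i)\<close>, and \<open>V\<close> the prime-to-p parts of the denominator.
    As \<open>a $ i < p\<close>, both \<open>E\<close> and \<open>V\<close> are prime to p.\<close>
  define R where "R A k = (\<Prod>r\<in>{1..A}. ?p * dot c k + r)" for A k
  define E where "E k = (\<Prod>i\<in>UNIV. (\<Prod>r\<in>{1..a $ i}. ?p * k $ i + r) ^ (c $ i))" for k :: "nat ^ 'd"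
  define V where "V k = (\<Prod>i\<in>UNIV. ?U (k $ i) ^ (c $ i))" for k :: "nat ^ 'd"
  have nat_eq: "multinom c (a + ?p *s k) * (V k * E k) = multinom c k * (?U (dot c k) * R (dot c a) k)" for k
  proof -
    have "fact_prod c (a + ?p *s k)
        = (\<Prod>i\<in>UNIV. (?p ^ k $ i * fact (k $ i) * ?U (k $ i) * (\<Prod>r\<in>{1..a $ i}. ?p * k $ i + r)) ^ (c $ i))"
      unfolding fact_prod_def
      by (simp add: add.commute[of "a $ _"] fact_add_eq_prod fact_mult_prime[OF p(2)])
    also have "\<dots> = ?p ^ dot c k * fact_prod c k * (V k * E k)"
      by (simp add: power_mult_distrib prod.distrib fact_prod_def V_def E_def dot_def power_sum
          mult.commute[of "k $ _"] flip: power_mult)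
    finally have "(?p ^ dot c k * fact_prod c k) * (multinom c (a + ?p *s k) * (V k * E k))
        = multinom c (a + ?p *s k) * fact_prod c (a + ?p *s k)"
      by (simp only: ac_simps)
    also have "\<dots> = fact (dot c (a + ?p *s k))" by (rule multinom_mult)
    also have "\<dots> = ?p ^ dot c k * fact (dot c k) * ?U (dot c k) * R (dot c a) k"
      by (simp add: dot_add dot_scale add.commute[of "dot c a"] fact_add_eq_prod fact_mult_prime[OF p(2)] R_def)
    also have "\<dots> = (?p ^ dot c k * fact_prod c k) * (multinom c k * (?U (dot c k) * R (dot c a) k))"
      unfolding multinom_mult[symmetric] by (simp only: ac_simps)
    finally show ?thesis using p(2) fact_prod_pos[of c k] by simp
  qed
  have V1: "of_nat (V k) dvd (1 :: 'p padic_int)" for k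
    unfolding V_def using coprime_prime_to_fact[OF p(1)]
    by (intro of_nat_dvd_one_padic_int prod_coprime_left) simp
  have E1: "of_nat (E k) dvd (1 :: 'p padic_int)" for k
    unfolding E_def
  proof (intro of_nat_dvd_one_padic_int prod_coprime_left)
    fix i show "coprime ((\<Prod>r\<in>{1..a $ i}. ?p * k $ i + r) ^ (c $ i)) ?p"
      using a[of i] by (auto intro!: prod_coprime_left coprime_mult_add p)
  qed
  have "\<exists>\<rho>. \<forall>k. of_nat (V k) * \<rho> k = (of_nat (?U (dot c k)) :: 'p padic_int)"
    by (intro choice allI ex_unit_quotient V1)
  then obtain \<rho> where \<rho>: "\<And>k. of_nat (V k) * \<rho> k = (of_nat (?U (dot c k)) :: 'p padic_int)"
    by blast
  have "\<exists>\<eta>. \<forall>k. of_nat (E k) * \<eta> k = (1 :: 'p padic_int)"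
    by (intro choice allI ex_unit_quotient E1)
  then obtain \<eta> where \<eta>: "\<And>k. of_nat (E k) * \<eta> k = (1 :: 'p padic_int)"
    by blast
  have "lip 1 \<rho>" by (rule lip_prime_to_fact_quotient) (use \<rho> in \<open>simp add: V_def\<close>)
  have lipE: "lip 1 (\<lambda>k. of_nat (E k) :: 'p padic_int)"
    unfolding E_def of_nat_prod of_nat_power
    by (intro lip_prod lip_power lip_of_nat_affine(2)) simp_all
  have "lip 1 \<eta>" by (rule lip_quotient[OF lip_const lipE E1 \<eta>])
  have lipR: "lip 1 (\<lambda>k. of_nat (R A k) :: 'p padic_int)" for A
    unfolding R_def of_nat_prod
    by (intro lip_prod lip_of_nat_affine(2)) (simp_all add: dot_add dot_scale)
  \<comment> \<open>A factor with \<open>r = p * b\<close> yields one \<pi> and leaves the cofactor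
    \<open>dot c k + b\<close>, for which the bound drops to \<open>lip 0\<close>. The other factors
    go into \<open>H\<close> unchanged.\<close>
  have "\<exists>H. lip 0 H \<and> (\<forall>k. of_nat (R A k) = (\<pi> ^ (A div ?p) * H k :: 'p padic_int))" for A
  proof (induction A)
    case 0
    then show ?case by (intro exI[of _ "\<lambda>_. 1"]) (simp add: R_def)
  next
    case (Suc A)
    then obtain H where H: "lip 0 H" "\<And>k. of_nat (R A k) = (\<pi> ^ (A div ?p) * H k :: 'p padic_int)"
      by blast
    have R: "R (Suc A) k = R A k * (?p * dot c k + Suc A)" for k by (simp add: R_def)
    show ?case
    proof (cases "Suc A mod ?p = 0")
      case True
      define b where "b = Suc A div ?p"
      have b: "Suc A = ?p * b" using True by (simp add: b_def mult.commute mod_0_imp_dvd)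
      have d: "Suc A div ?p = Suc (A div ?p)" using True by (simp add: div_Suc)
      have "R (Suc A) k = R A k * (?p * (dot c k + b))" for k
        by (subst R) (simp only: b distrib_left)
      then have "of_nat (R (Suc A) k) = \<pi> ^ (Suc A div ?p) * (H k * of_nat (dot c k + b))" for k
        by (simp add: H(2) d ac_simps del: of_nat_add)
      moreover have "lip 0 (\<lambda>k. H k * of_nat (dot c k + b))"
        using H(1) by (intro lip_mult lip_of_nat_affine(1)) (simp_all add: dot_add dot_scale)
      ultimately show ?thesis by blast
    next
      case False
      then have "Suc A div ?p = A div ?p" by (simp add: div_Suc)
      then have "of_nat (R (Suc A) k) = \<pi> ^ (Suc A div ?p) * (H k * of_nat (?p * dot c k + Suc A))" for k
        unfolding R by (simp add: H(2) algebra_simps)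
      moreover have "lip 0 (\<lambda>k. of_nat (?p * dot c k + Suc A) :: 'p padic_int)"
        using lip_of_nat_affine(2)[of "dot c" "Suc A", OF dot_add dot_scale] by (rule lip_mono) simp
      then have "lip 0 (\<lambda>k. H k * of_nat (?p * dot c k + Suc A))"
        using H(1) by (intro lip_mult)
      ultimately show ?thesis by blast
    qed
  qed
  then obtain H where H: "lip 0 H" "\<And>k. of_nat (R (dot c a) k) = (\<pi> ^ (dot c a div ?p) * H k :: 'p padic_int)"
    by blast
  show ?thesis
  proof
    show "lip 1 (\<lambda>k. \<rho> k * of_nat (R (dot c a) k) * \<eta> k)"
      by (intro lip_mult lipR \<open>lip 1 \<rho>\<close> \<open>lip 1 \<eta>\<close>)
    show "lip 0 (\<lambda>k. \<rho> k * H k * \<eta> k)"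
      using \<open>lip 1 \<rho>\<close> \<open>lip 1 \<eta>\<close> by (intro lip_mult H(1)) (auto intro: lip_mono)
    show "\<rho> k * of_nat (R (dot c a) k) * \<eta> k = \<pi> ^ (dot c a div ?p) * (\<rho> k * H k * \<eta> k)" for k
      by (simp add: H(2) ac_simps)
    fix k
    let ?M = "of_nat (multinom c (a + ?p *s k)) :: 'p padic_int" and ?V = "of_nat (V k) :: 'p padic_int"
    have "?V * ?M = ?V * ?M * (of_nat (E k) * \<eta> k)" by (simp add: \<eta>)
    also have "\<dots> = of_nat (multinom c (a + ?p *s k) * (V k * E k)) * \<eta> k" by (simp add: ac_simps)
    also have "\<dots> = of_nat (multinom c k) * (of_nat (?U (dot c k)) * of_nat (R (dot c a) k)) * \<eta> k"
      by (simp only: nat_eq of_nat_mult)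
    also have "\<dots> = ?V * (of_nat (multinom c k) * (\<rho> k * of_nat (R (dot c a) k) * \<eta> k))"
      by (simp add: ac_simps flip: \<rho>)
    finally show "?M = of_nat (multinom c k) * (\<rho> k * of_nat (R (dot c a) k) * \<eta> k)"
      using V1[of k] by auto
  qed
qed

lemma multinom_prod_shift:
  fixes a :: "nat ^ 'd"
  assumes a: "\<And>k. a $ k < CARD('p::prime_card)"
  obtains G H :: "nat ^ 'd \<Rightarrow> 'p::prime_card padic_int" where "lip 1 G" "lip 0 H"
    "\<And>k. of_nat (multinom_prod e (a + CARD('p) *s k)) = of_nat (multinom_prod e k) * G k"
    "\<And>k. G k = \<pi> ^ (\<Sum>c\<leftarrow>e. dot c a div CARD('p)) * H k"
proof (induction e arbitrary: thesis)
  case Nil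
  show ?case by (rule Nil[of "\<lambda>_. 1" "\<lambda>_. 1"]) (simp_all add: multinom_prod_def)
next
  case (Cons c e)
  obtain G H :: "nat ^ 'd \<Rightarrow> 'p padic_int" where GH: "lip 1 G" "lip 0 H"
    "\<And>k. of_nat (multinom_prod e (a + CARD('p) *s k)) = of_nat (multinom_prod e k) * G k"
    "\<And>k. G k = \<pi> ^ (\<Sum>c\<leftarrow>e. dot c a div CARD('p)) * H k"
    using Cons.IH by blast
  obtain G' H' :: "nat ^ 'd \<Rightarrow> 'p padic_int" where GH': "lip 1 G'" "lip 0 H'"
    "\<And>k. of_nat (multinom c (a + CARD('p) *s k)) = of_nat (multinom c k) * G' k"
    "\<And>k. G' k = \<pi> ^ (dot c a div CARD('p)) * H' k"
    using multinom_shift[OF a, of c] by blast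
  show ?case
  proof (rule Cons.prems)
    show "lip 1 (\<lambda>k. G k * G' k)" "lip 0 (\<lambda>k. H k * H' k)"
      by (rule lip_mult, fact+)+
    show "of_nat (multinom_prod (c # e) (a + CARD('p) *s k))
        = of_nat (multinom_prod (c # e) k) * (G k * G' k)" for k
      using GH(3)[of k] GH'(3)[of k] by (simp add: multinom_prod_def)
    show "G k * G' k = \<pi> ^ (\<Sum>c\<leftarrow>c # e. dot c a div CARD('p)) * (H k * H' k)" for k
      by (simp add: GH(4) GH'(4) power_add)
  qed
qed

section \<open>Weighted sums\<close>

lemma weight_add: "weight (n + m) = weight n + weight m"
  by (simp add: weight_def sum.distrib)

lemma weight_scale: "weight (t *s n) = t * weight n"
  by (simp add: weight_def sum_distrib_left)

text \<open>For \<open>s > 0\<close> a component bounded below by \<open>1\<close> works. For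
  \<open>s = 0\<close> take the coordinate \<open>k\<close> where \<open>a\<close> is largest and a
  component with entry at least \<open>CARD('d)\<close> there, since \<open>weight a\<close> is at
  most \<open>CARD('d) * a $ k\<close>.\<close>

lemma admissible_dot_ge_weight:
  fixes e :: "(nat ^ 'd) list"
  assumes "admissible r e" "r > 0"
  shows "\<exists>c\<in>set e. weight a \<le> dot c a"
proof -
  obtain s where "(s = 0 \<or> (\<exists>I\<subseteq>{..<length e}. card I = s \<and> (\<forall>i\<in>I. e ! i \<ge> 1))) \<and>
    (s = r \<or> (\<forall>k. \<exists>I\<subseteq>{..<length e}. card I = r - s \<and> (\<forall>i\<in>I. e ! i \<ge> axis k CARD('d))))"
    using assms(1) unfolding admissible_def by (rule bexE)
  note s = conjunct1[OF this] conjunct2[OF this]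
  show ?thesis
  proof (cases "s = 0")
    case False
    then obtain I where I: "I \<subseteq> {..<length e}" "card I \<noteq> 0" "\<forall>i\<in>I. e ! i \<ge> 1"
      using s(1) by auto
    then obtain i where i: "i < length e" "e ! i \<ge> 1"
      by (metis card.empty ex_in_conv lessThan_iff subsetD)
    then have "weight a \<le> dot (e ! i) a"
      unfolding weight_def dot_def less_eq_vec_def by (intro sum_mono) auto
    with i show ?thesis by auto
  next
    case True
    obtain k where k: "\<And>i. a $ i \<le> a $ k"
    proof -
      have "Max (range (($) a)) \<in> range (($) a)" by (intro Max_in) auto
      then obtain k where "Max (range (($) a)) = a $ k" by (rule rangeE)
      then show ?thesis using that[of k] Max_ge[of "range (($) a)"] by auto
    qed
    obtain I where I: "I \<subseteq> {..<length e}" "card I \<noteq> 0" "\<forall>i\<in>I. e ! i \<ge> axis k CARD('d)"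
      using s(2)[unfolded True] assms(2) by (metis diff_zero less_not_refl2)
    then obtain i where i: "i < length e" "e ! i \<ge> axis k CARD('d)"
      by (metis card.empty ex_in_conv lessThan_iff subsetD)
    have "weight a \<le> (\<Sum>i::'d\<in>UNIV. a $ k)" unfolding weight_def by (intro sum_mono k)
    also have "\<dots> \<le> e ! i $ k * a $ k"
      using i(2) unfolding less_eq_vec_def by (auto simp: axis_def dest: spec[of _ k])
    also have "\<dots> \<le> dot (e ! i) a"
      unfolding dot_def by (rule member_le_sum) auto
    finally show ?thesis using i by auto
  qed
qed

text \<open>The sum is the exponent of \<pi> in \<open>multinom_prod_shift\<close>; a single
  component already accounts for \<open>j\<close>.\<close>

lemma admissible_landau:
  assumes "admissible r e" "r > 0" "p > 0" "p * j \<le> weight a"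
  shows "j \<le> (\<Sum>c\<leftarrow>e. dot c a div p)"
proof -
  obtain c where c: "c \<in> set e" "weight a \<le> dot c a"
    using admissible_dot_ge_weight[OF assms(1,2)] by blast
  have "j \<le> dot c a div p"
    using assms c(2) by (simp add: less_eq_div_iff_mult_less_eq mult.commute)
  also have "\<dots> \<le> (\<Sum>c\<leftarrow>e. dot c a div p)"
    using c(1) by (intro member_le_sum_list) auto
  finally show ?thesis .
qed

definition wsum :: "(nat ^ 'd) list \<Rightarrow> (nat ^ 'd \<Rightarrow> 'p::prime_card padic_int) \<Rightarrow> nat \<Rightarrow> 'p padic_int"
  where "wsum e g N = (\<Sum>n | weight n = N. of_nat (multinom_prod e n) * g n)"

lemma wsum_scale: "wsum e (\<lambda>n. c * g n) N = c * wsum e g N"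
  by (simp add: wsum_def sum_distrib_left ac_simps)

lemma wsum_const_add: "wsum e (\<lambda>n. c + d * g n) N = c * wsum e (\<lambda>_. 1) N + d * wsum e g N"
  by (simp add: wsum_def sum_distrib_left algebra_simps sum.distrib)

text \<open>
  Group the vectors \<open>n\<close> of weight \<open>v + p * m\<close> by their residue vector \<open>a\<close> modulo \<open>p\<close>,
  which has weight \<open>v + p * j\<close>.  For \<open>j = 0\<close> the ratio \<open>G\<close> is constant up to \<open>\<pi>\<close> times a
  Lipschitz function; for \<open>j > 0\<close> it is divisible by \<open>\<pi> ^ j\<close>, which makes up for the digits
  lost in the borrow \<open>m - j\<close>.
\<close>

lemma wsum_step:
  fixes e :: "(nat ^ 'd) list" and g :: "nat ^ 'd \<Rightarrow> 'p::prime_card padic_int" and Z :: "nat set"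
  defines "dc \<equiv> digit_count CARD('p) Z"
  assumes adm: "admissible r e" "r > 0" and Z: "0 \<notin> Z" and g: "lip 0 g"
    and A: "\<pi> ^ dc m dvd wsum e (\<lambda>_. 1 :: 'p padic_int) m"
    and B: "\<And>i h. i \<le> m \<Longrightarrow> lip 0 h \<Longrightarrow> \<pi> ^ dc (i div CARD('p)) dvd wsum e (h :: _ \<Rightarrow> 'p padic_int) i"
    and v: "v < CARD('p)"
  shows "\<pi> ^ dc m dvd wsum e g (v + CARD('p) * m)"
proof -
  let ?p = "CARD('p)"
  have p: "1 < ?p" using padic_prime_gt_1[where 'p = 'p] by simp
  define S where "S = {n :: nat ^ 'd. weight n = v + ?p * m}"
  define res where "res n = (\<chi> k. n $ k mod ?p)" for n :: "nat ^ 'd"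
  define quo where "quo n = (\<chi> k. n $ k div ?p)" for n :: "nat ^ 'd"
  define q where "q n = of_nat (multinom_prod e n) * g n" for n
  have fin: "finite S" unfolding S_def by (rule finite_weight)
  have split: "n = res n + ?p *s quo n" for n
    by (simp add: res_def quo_def vec_eq_iff)
  have "\<pi> ^ dc m dvd sum q {n \<in> S. res n = a}" if "a \<in> res ` S" for a
  proof -
    obtain n0 where n0: "weight n0 = v + ?p * m" "a = res n0"
      using \<open>a \<in> res ` S\<close> by (auto simp: S_def)
    have a: "a $ k < ?p" for k by (simp add: n0 res_def)
    have wt: "weight a + ?p * weight (quo n0) = v + ?p * m"
      using arg_cong[OF split[of n0], of weight] n0 by (simp add: weight_add weight_scale)
    define j where "j = weight a div ?p"
    have "weight a mod ?p = v"
      using arg_cong[OF wt, of "\<lambda>x. x mod ?p"] v by simp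
    then have wa: "weight a = v + ?p * j"
      unfolding j_def by (metis mod_mult_div_eq)
    with wt have "?p * (j + weight (quo n0)) = ?p * m" by (simp add: algebra_simps)
    then have j: "j \<le> m" using p by auto
    have inj: "inj_on (\<lambda>k. a + ?p *s k) {k. weight k = m - j}"
      using p by (auto simp: inj_on_def vec_eq_iff)
    have fibre: "{n \<in> S. res n = a} = (\<lambda>k. a + ?p *s k) ` {k. weight k = m - j}"
    proof (intro set_eqI iffI)
      fix n assume n: "n \<in> {n \<in> S. res n = a}"
      then have eq: "n = a + ?p *s quo n" using split[of n] by simp
      have "?p * (j + weight (quo n)) = ?p * m"
        using arg_cong[OF eq, of weight] n wa by (simp add: S_def weight_add weight_scale distrib_left)
      then have "weight (quo n) = m - j" using p by auto
      with eq show "n \<in> (\<lambda>k. a + ?p *s k) ` {k. weight k = m - j}" by blast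
    next
      fix n assume "n \<in> (\<lambda>k. a + ?p *s k) ` {k. weight k = m - j}"
      then obtain k where k: "n = a + ?p *s k" "weight k = m - j" by blast
      have "res n = a" using a by (simp add: res_def k vec_eq_iff)
      moreover have "weight n = v + ?p * m"
        using j by (simp add: k weight_add weight_scale wa diff_mult_distrib2)
      ultimately show "n \<in> {n \<in> S. res n = a}" by (simp add: S_def)
    qed
    obtain G H :: "nat ^ 'd \<Rightarrow> 'p padic_int" where G: "lip 1 G" and H: "lip 0 H"
      and QG: "\<And>k. of_nat (multinom_prod e (a + ?p *s k)) = of_nat (multinom_prod e k) * G k"
      and GH: "\<And>k. G k = \<pi> ^ (\<Sum>c\<leftarrow>e. dot c a div ?p) * H k"
      using multinom_prod_shift[OF a, of e] by blast
    define F where "F k = G k * g (a + ?p *s k)" for k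
    have "sum q {n \<in> S. res n = a} = wsum e F (m - j)"
      unfolding fibre sum.reindex[OF inj] wsum_def q_def F_def
      by (rule sum.cong) (simp_all add: QG)
    also have "\<pi> ^ dc m dvd \<dots>"
    proof (cases "j = 0")
      case True
      have "lip 1 F" unfolding F_def using G lip_shift[OF g] by (intro lip_mult) simp_all
      then obtain h where h: "lip 0 h" "\<And>n. F n = F 0 + \<pi> * h n"
        using lip_Suc_decompose[of 0 F] by (metis One_nat_def)
      have "wsum e F m = wsum e (\<lambda>n. F 0 + \<pi> * h n) m" using h(2) by metis
      then have eq: "wsum e F m = F 0 * wsum e (\<lambda>_. 1) m + \<pi> * wsum e h m"
        by (simp only: wsum_const_add)
      \<comment> \<open>\<open>B\<close> speaks of \<open>m div p\<close> and so may miss the last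
        digit of \<open>m\<close>; the factor \<pi> in front of \<open>h\<close> makes up for
        it.\<close>
      have "dc m \<le> Suc (dc (m div ?p))"
        unfolding dc_def using digit_count_div[OF p Z, of m] by simp
      then have "\<pi> ^ dc m dvd (\<pi> ^ Suc (dc (m div ?p)) :: 'p padic_int)"
        by (rule le_imp_power_dvd)
      also have "\<dots> dvd \<pi> * wsum e h m" using B[OF order_refl h(1)] by (simp add: mult_dvd_mono)
      finally show ?thesis using A by (simp add: eq True)
    next
      case False
      define t where "t = (\<Sum>c\<leftarrow>e. dot c a div ?p)"
      have "j \<le> t" unfolding t_def using adm p wa by (intro admissible_landau) auto
      then have "dc m \<le> t + dc ((m - j) div ?p)"
        unfolding dc_def using digit_count_diff_div[OF p Z, of j m] j False by simp
      then have "\<pi> ^ dc m dvd (\<pi> ^ (t + dc ((m - j) div ?p)) :: 'p padic_int)"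
        by (rule le_imp_power_dvd)
      also have "\<dots> dvd \<pi> ^ t * wsum e (\<lambda>k. H k * g (a + ?p *s k)) (m - j)"
      proof -
        have "lip 0 (\<lambda>k. H k * g (a + ?p *s k))"
          using H lip_mono[OF lip_shift[OF g]] by (intro lip_mult) simp_all
        from B[OF _ this, of "m - j"] show ?thesis by (simp add: power_add mult_dvd_mono)
      qed
      also have "\<dots> = wsum e F (m - j)"
        unfolding F_def GH t_def wsum_scale[symmetric] by (simp add: mult.assoc)
      finally show ?thesis .
    qed
    finally show ?thesis .
  qed
  then have "\<pi> ^ dc m dvd (\<Sum>a\<in>res ` S. sum q {n \<in> S. res n = a})" by (rule dvd_sum)
  also have "(\<Sum>a\<in>res ` S. sum q {n \<in> S. res n = a}) = wsum e g (v + ?p * m)"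
    using fin by (subst sum.group) (auto simp: wsum_def q_def S_def)
  finally show ?thesis .
qed

section \<open>The recurrence\<close>

lemma to_fract_of_nat: "to_fract (of_nat n) = of_nat n"
  by (simp add: to_fract_def of_nat_fract)

lemma to_fract_power: "to_fract (x ^ n) = to_fract x ^ n"
  by (induction n) simp_all

lemma to_fract_sum: "to_fract (sum f A) = (\<Sum>i\<in>A. to_fract (f i))"
  by (induction A rule: infinite_finite_induct) simp_all

lemma theta_funpow_nth: "fps_nth ((theta ^^ j) F) n = of_nat n ^ j * fps_nth F n"
  by (induction j arbitrary: n) (auto simp: theta_def ac_simps)

lemma poly_theta_nth:
  "fps_nth (poly_theta P F) n = to_fract (poly P (of_nat n)) * fps_nth F n"
  by (simp add: poly_theta_def fps_sum_nth theta_funpow_nth poly_altdef to_fract_sum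
      to_fract_power to_fract_of_nat sum_distrib_right mult.assoc)

text \<open>\<open>theta\<close> multiplies the coefficient of \<open>z ^ n\<close> by
  \<open>n\<close>, so this compares coefficients of \<open>z ^ n\<close>. The bound
  \<open>min q n\<close> keeps \<open>n - k\<close> free of truncation.\<close>

lemma diff_op_recurrence:
  assumes "diff_op q P (Abs_fps (\<lambda>m. to_fract (s m))) = 0"
  shows "(\<Sum>k\<le>min q n. poly (P k) (of_nat (n - k)) * s (n - k)) = 0"
proof -
  let ?f = "\<lambda>k. poly (P k) (of_nat (n - k)) * s (n - k)"
  have "0 = (\<Sum>k\<le>q. if n < k then 0 else to_fract (?f k))"
    using arg_cong[OF assms, of "\<lambda>F. fps_nth F n"]
    by (simp add: diff_op_def fps_sum_nth fps_X_power_mult_nth poly_theta_nth if_distrib cong: if_cong)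
  also have "\<dots> = (\<Sum>k\<le>min q n. to_fract (?f k))"
    by (rule sum.mono_neutral_cong_right) auto
  finally have "to_fract (\<Sum>k\<le>min q n. ?f k) = 0" by (simp only: to_fract_sum)
  then show ?thesis by (simp only: to_fract_eq_0_iff)
qed

lemma poly_dvd_poly:
  fixes x :: "'a::comm_ring_1"
  assumes "p dvd q"
  shows "poly p x dvd poly q x"
proof -
  obtain r where "q = p * r" using assms by (rule dvdE)
  then show ?thesis by simp
qed

lemma poly_dvd_diff: "d dvd x - y \<Longrightarrow> d dvd poly P x - poly P (y :: 'a::comm_ring_1)"
  unfolding poly_altdef sum_subtractf[symmetric]
  by (intro dvd_sum) (auto simp: right_diff_distrib[symmetric] intro!: dvd_mult dvd_power_diff_power)

text \<open>Subtract \<open>s (p * m)\<close> times the recurrence at \<open>v\<close> from the one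
  at \<open>v + p * m\<close>. The values of \<open>P k\<close> agree modulo \<pi> and multiply
  values of \<open>s\<close> divisible by \<open>\<pi> ^ c\<close>, so the terms with
  \<open>1 \<le> k \<le> v\<close> cancel by induction. Those with \<open>k > v\<close> reach below
  \<open>p * m\<close> and are left to \<open>high\<close>. The term of \<open>P 0\<close> remains.
  The bound \<open>u\<close> restricts \<open>high\<close> to the digits that matter.\<close>

lemma recurrence_congruence:
  fixes s :: "nat \<Rightarrow> 'p::prime_card padic_int"
  assumes rec: "\<And>n. (\<Sum>k\<le>min q n. poly (P k) (of_nat (n - k)) * s (n - k)) = 0"
    and s0: "s 0 = 1" and unit: "unit_preserving (P 0)"
    and B: "\<And>v. v < CARD('p) \<Longrightarrow> \<pi> ^ c dvd s (v + CARD('p) * m)"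
    and high: "\<And>v k. 1 \<le> v \<Longrightarrow> v \<le> u \<Longrightarrow> v < k \<Longrightarrow> k \<le> q \<Longrightarrow> k \<le> v + CARD('p) * m \<Longrightarrow>
      \<pi> ^ Suc c dvd poly (P k) (of_nat (v + CARD('p) * m - k)) * s (v + CARD('p) * m - k)"
    and u: "u < CARD('p)" and "v \<le> u"
  shows "\<pi> ^ Suc c dvd s (v + CARD('p) * m) - s v * s (CARD('p) * m)"
  using \<open>v \<le> u\<close>
proof (induction v rule: less_induct)
  case (less v)
  let ?p = "CARD('p)" and ?d = "\<pi> ^ Suc c :: 'p padic_int"
  show ?case
  proof (cases "v = 0")
    case True
    then show ?thesis by (simp add: s0)
  next
    case False
    define n where "n = v + ?p * m"
    define T where "T k = poly (P k) (of_nat (n - k)) * s (n - k)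
      - poly (P k) (of_nat (v - k)) * s (v - k) * s (?p * m)" for k
    have T: "?d dvd T k - poly (P k) (of_nat (v - k)) * (s (n - k) - s (v - k) * s (?p * m))"
      if "k \<le> v" for k
    proof -
      have nk: "n - k = (v - k) + ?p * m" using that by (simp add: n_def)
      have "\<pi> dvd poly (P k) (of_nat (n - k)) - poly (P k) (of_nat (v - k))"
        by (rule poly_dvd_diff) (simp add: nk)
      moreover have "\<pi> ^ c dvd s (n - k)" unfolding nk using less.prems u by (intro B) simp
      ultimately have "\<pi> * \<pi> ^ c dvd
          (poly (P k) (of_nat (n - k)) - poly (P k) (of_nat (v - k))) * s (n - k)"
        by (rule mult_dvd_mono)
      then show ?thesis by (simp add: T_def algebra_simps)
    qed
    have T_pos: "?d dvd T k" if "1 \<le> k" "k \<le> v" for k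
    proof -
      have "?d dvd s (n - k) - s (v - k) * s (?p * m)"
        using less.IH[of "v - k"] less.prems that by (simp add: n_def)
      then have "?d dvd poly (P k) (of_nat (v - k)) * (s (n - k) - s (v - k) * s (?p * m))"
        by (rule dvd_mult)
      from dvd_add[OF T[OF that(2)] this] show ?thesis by simp
    qed
    have v_le: "min q v \<le> min q n" by (auto simp: n_def)
    have "(\<Sum>k\<le>min q v. T k) + (\<Sum>k\<in>{min q v<..min q n}. poly (P k) (of_nat (n - k)) * s (n - k))
        = (\<Sum>k\<le>min q n. poly (P k) (of_nat (n - k)) * s (n - k))
          - (\<Sum>k\<le>min q v. poly (P k) (of_nat (v - k)) * s (v - k)) * s (?p * m)"
    proof -
      have "{..min q n} = {..min q v} \<union> {min q v<..min q n}" using v_le by auto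
      then have "(\<Sum>k\<le>min q n. poly (P k) (of_nat (n - k)) * s (n - k))
          = (\<Sum>k\<le>min q v. poly (P k) (of_nat (n - k)) * s (n - k))
            + (\<Sum>k\<in>{min q v<..min q n}. poly (P k) (of_nat (n - k)) * s (n - k))"
        by (simp only:) (rule sum.union_disjoint; auto)
      then show ?thesis
        by (simp add: T_def sum_subtractf sum_distrib_right)
    qed
    then have "(\<Sum>k\<le>min q v. T k)
        + (\<Sum>k\<in>{min q v<..min q n}. poly (P k) (of_nat (n - k)) * s (n - k)) = 0"
      by (simp only: rec mult_zero_left diff_zero)
    then have "(\<Sum>k\<le>min q v. T k)
        = - (\<Sum>k\<in>{min q v<..min q n}. poly (P k) (of_nat (n - k)) * s (n - k))"
      by (simp only: eq_neg_iff_add_eq_0)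
    moreover have "?d dvd (\<Sum>k\<in>{min q v<..min q n}. poly (P k) (of_nat (n - k)) * s (n - k))"
      using high[of v] less.prems False by (intro dvd_sum) (auto simp: n_def min_def split: if_splits)
    ultimately have "?d dvd (\<Sum>k\<le>min q v. T k)" by (simp only: dvd_minus_iff)
    moreover have "(\<Sum>k\<le>min q v. T k) = T 0 + (\<Sum>k\<in>{1..min q v}. T k)"
      by (simp add: atMost_atLeast0 sum.atLeast_Suc_atMost)
    moreover have "?d dvd (\<Sum>k\<in>{1..min q v}. T k)" by (intro dvd_sum T_pos) auto
    ultimately have "?d dvd T 0" by (simp add: dvd_add_left_iff)
    from dvd_diff[OF this T[of 0]]
    have "?d dvd poly (P 0) (of_nat v) * (s n - s v * s (?p * m))" by simp
    \<comment> \<open>Here \<open>1 \<le> v < p\<close>, so \<open>v\<close> is a unit and so is the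
      value of \<open>P 0\<close> at it.\<close>
    moreover have "poly (P 0) (of_nat v) dvd 1"
    proof -
      have "coprime v ?p"
        using coprime_mult_add[OF prime_card[where 'a = 'p], of v 0] False less.prems u by simp
      then have "(of_nat v :: 'p padic_int) dvd 1" by (rule of_nat_dvd_one_padic_int)
      then show ?thesis using unit by (auto simp: unit_preserving_def)
    qed
    ultimately show ?thesis unfolding n_def by (metis unit_dvd_cancel)
  qed
qed

text \<open>The multiples \<open>p * y\<close> with \<open>a < y \<le> b\<close> all lie among
  \<open>n + 1, ..., n + k - 1\<close>.\<close>

lemma power_dvd_prod_consecutive:
  fixes p :: nat
  assumes "0 < p" "n < p * Suc a" "p * b < n + k"
  shows "p ^ (b - a) dvd (\<Prod>i=1..k - 1. i + n)"
proof -
  define A where "A = (\<lambda>y. p * y - n) ` {a<..b}"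
  have gt: "n < p * y" if "a < y" for y
    using assms(2) mult_le_mono2[of "Suc a" y p] that by linarith
  have "A \<subseteq> {1..k - 1}"
  proof
    fix i assume "i \<in> A"
    then obtain y where y: "i = p * y - n" "a < y" "y \<le> b" by (auto simp: A_def)
    then show "i \<in> {1..k - 1}"
      using gt[OF y(2)] mult_le_mono2[OF y(3), of p] assms(3)
      unfolding y(1) atLeastAtMost_iff by linarith
  qed
  then have dvd: "(\<Prod>i\<in>A. i + n) dvd (\<Prod>i=1..k - 1. i + n)" by (intro prod_dvd_prod_subset) auto
  have "inj_on (\<lambda>y. p * y - n) {a<..b}"
  proof (rule inj_onI)
    fix x y assume xy: "x \<in> {a<..b}" "y \<in> {a<..b}" "p * x - n = p * y - n"
    then have "n < p * x" "n < p * y" by (auto intro: gt)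
    with xy(3) have "p * x = p * y" by linarith
    then show "x = y" using assms(1) by simp
  qed
  then have "(\<Prod>i\<in>A. i + n) = (\<Prod>y\<in>{a<..b}. p * y)"
    unfolding A_def by (subst prod.reindex) (auto intro!: prod.cong le_add_diff_inverse2 less_imp_le gt)
  also have "\<dots> = p ^ (b - a) * \<Prod>{a<..b}" by (simp add: prod.distrib)
  finally show ?thesis using dvd by (metis dvd_mult_left)
qed

text \<open>Type I: descending by \<open>t \<ge> 1\<close> blocks loses at most \<open>t\<close>
  counted digits, while the squared product supplies \<open>\<pi> ^ (2 * t)\<close>. Type II: only
  \<open>k = 2\<close>, \<open>v = 1\<close> occur, so the index is \<open>p * m - 1\<close>. Its
  last digit \<open>p - 1\<close> counts and offsets the passage from \<open>m\<close> to
  \<open>m - 1\<close>; the factor \<open>X + 1\<close> takes the value \<open>p * m\<close> there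
  and provides the extra \<pi>.\<close>

lemma high_terms_dvd:
  fixes s :: "nat \<Rightarrow> 'p::prime_card padic_int" and Z :: "nat set"
  defines "dc \<equiv> digit_count CARD('p) Z"
  assumes Z: "0 \<notin> Z" and "type_I q P \<or> (type_II q P \<and> CARD('p) - 1 \<in> Z)"
    and v: "1 \<le> v" "v < CARD('p)" and k: "v < k" "k \<le> q" "k \<le> v + CARD('p) * m"
    and A: "\<And>n. n < v + CARD('p) * m \<Longrightarrow> \<pi> ^ dc n dvd s n"
  shows "\<pi> ^ Suc (dc m) dvd poly (P k) (of_nat (v + CARD('p) * m - k)) * s (v + CARD('p) * m - k)"
proof -
  let ?p = "CARD('p)"
  have p: "1 < ?p" using padic_prime_gt_1[where 'p = 'p] by simp
  define n where "n = v + ?p * m - k"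
  have An: "\<pi> ^ dc n dvd s n" by (rule A) (use k in \<open>simp add: n_def\<close>)
  note dc_div = digit_count_div[OF p Z, folded dc_def]
  have "\<exists>t. \<pi> ^ t dvd poly (P k) (of_nat n) \<and> Suc (dc m) \<le> t + dc n"
    using assms(3)
  proof
    assume type: "type_I q P"
    define t where "t = m - n div ?p"
    have "n < ?p * m" using k by (simp add: n_def)
    then have lt: "n div ?p < m" using p by (simp add: div_less_iff_less_mult mult.commute)
    have "(\<Prod>i=1..k - 1. [:of_nat i, 1:]\<^sup>2) dvd P k"
      using type k v by (auto simp: type_I_def)
    then have "poly (\<Prod>i=1..k - 1. [:of_nat i, 1:]\<^sup>2) (of_nat n) dvd poly (P k) (of_nat n)"
      by (rule poly_dvd_poly)
    moreover have "poly (\<Prod>i=1..k - 1. [:of_nat i, 1:]\<^sup>2) (of_nat n)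
        = (of_nat (\<Prod>i=1..k - 1. i + n) :: 'p padic_int)\<^sup>2"
      by (simp add: poly_prod poly_power prod_power_distrib)
    moreover have "\<pi> ^ t dvd (of_nat (\<Prod>i=1..k - 1. i + n) :: 'p padic_int)"
      unfolding of_nat_dvd_padic_int_iff t_def
    \<comment> \<open>The instance is \<open>a = n div p\<close>, \<open>b = m\<close>. The range
      reaches past \<open>p * m\<close> because \<open>n + k = v + p * m\<close> and
      \<open>v \<ge> 1\<close>.\<close>
    proof (rule power_dvd_prod_consecutive)
      show "n < ?p * Suc (n div ?p)" using p by (simp add: dividend_less_times_div)
      show "?p * m < n + k" using v k by (simp add: n_def)
    qed simp
    then have "(\<pi> ^ t)\<^sup>2 dvd (of_nat (\<Prod>i=1..k - 1. i + n) :: 'p padic_int)\<^sup>2"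
      by (rule dvd_power_same)
    ultimately have "(\<pi> ^ t)\<^sup>2 dvd poly (P k) (of_nat n)"
      by (simp only:) (rule dvd_trans)
    then have "\<pi> ^ (t * 2) dvd poly (P k) (of_nat n)" by (simp only: power_mult)
    moreover have "dc m \<le> dc (n div ?p) + t"
      using digit_count_add[OF p Z, of "n div ?p" t] lt by (simp add: dc_def t_def)
    then have "Suc (dc m) \<le> t * 2 + dc n" using dc_div[of n] lt by (simp add: t_def)
    ultimately show ?thesis by blast
  next
    assume "type_II q P \<and> ?p - 1 \<in> Z"
    then have type: "q = 2" "[:1, 1:] dvd P 2" and Z': "?p - 1 \<in> Z" by (auto simp: type_II_def)
    then have kv: "k = 2" "v = 1" using k v by auto
    then have m: "m \<noteq> 0" using k by auto
    then have n: "Suc n = ?p * m" using p by (cases m) (auto simp: n_def kv)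
    have "poly [:1, 1:] (of_nat n) dvd poly (P k) (of_nat n)"
      using type(2) kv by (intro poly_dvd_poly) simp
    moreover have "poly [:1, 1:] (of_nat n) = (of_nat (Suc n) :: 'p padic_int)" by simp
    ultimately have dvd: "\<pi> ^ 1 dvd poly (P k) (of_nat n)"
      unfolding n of_nat_mult by (metis dvd_mult_left power_one_right)
    have Suc: "Suc n mod ?p = 0" "Suc n div ?p = m" unfolding n using p by simp_all
    then have "Suc (n mod ?p) = ?p" by (simp add: mod_Suc split: if_splits)
    then have "n mod ?p = ?p - 1" by simp
    moreover have "n div ?p = m - 1" using Suc by (simp add: div_Suc)
    ultimately have "dc n = Suc (dc (m - 1))" using dc_div[of n] Z' by simp
    then have "Suc (dc m) \<le> 1 + dc n"
      using digit_count_Suc[OF p Z, of "m - 1"] m by (simp add: dc_def)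
    with dvd show ?thesis by blast
  qed
  then obtain t where t: "\<pi> ^ t dvd poly (P k) (of_nat n)" "Suc (dc m) \<le> t + dc n" by blast
  have "\<pi> ^ Suc (dc m) dvd (\<pi> ^ (t + dc n) :: 'p padic_int)" using t(2) by (rule le_imp_power_dvd)
  also have "\<dots> dvd poly (P k) (of_nat n) * s n"
    unfolding power_add using t(1) An by (rule mult_dvd_mono)
  finally show ?thesis unfolding n_def .
qed

section \<open>The simultaneous induction\<close>

lemma wsum_0:
  fixes e :: "(nat ^ 'd) list"
  shows "wsum e g 0 = g 0"
proof -
  have "{n :: nat ^ 'd. weight n = 0} = {0}" by (auto simp: weight_def vec_eq_iff)
  then show ?thesis unfolding wsum_def by (simp only:) simp
qed

lemma uniformizer_not_unit: "\<not> \<pi> dvd (1 :: 'p::prime_card padic_int)"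
  using of_nat_dvd_padic_int_iff[of 1 1, where 'p = 'p] padic_prime_gt_1[where 'p = 'p] by simp

text \<open>\<open>wsum_step\<close> at \<open>m = n div p\<close> uses the hypothesis only up to
  \<open>m < n\<close> and gives \<open>\<pi> ^ dc m\<close> on the whole block of \<open>n\<close>.
  This is the second claim, and also the first if the last digit of \<open>n\<close> is not in
  \<open>Z\<close>; otherwise one more \<pi> comes from the congruence of \<open>s n\<close> with
  \<open>s v * s (p * m)\<close>.\<close>

lemma wsum_main:
  fixes e :: "(nat ^ 'd) list" and P :: "nat \<Rightarrow> 'p::prime_card padic_int poly" and Z :: "nat set"
  defines "dc \<equiv> digit_count CARD('p) Z" and "s \<equiv> wsum e (\<lambda>_. 1 :: 'p padic_int)"
  assumes adm: "admissible r e" "r > 0" and Z: "\<And>v. v \<in> Z \<longleftrightarrow> v < CARD('p) \<and> \<pi> dvd s v"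
    and rec: "\<And>n. (\<Sum>k\<le>min q n. poly (P k) (of_nat (n - k)) * s (n - k)) = 0"
    and type: "type_I q P \<or> (type_II q P \<and> CARD('p) - 1 \<in> Z)"
  shows "\<pi> ^ dc n dvd s n \<and> (\<forall>g :: _ \<Rightarrow> 'p padic_int. lip 0 g \<longrightarrow> \<pi> ^ dc (n div CARD('p)) dvd wsum e g n)"
proof (induction n rule: less_induct)
  case (less n)
  let ?p = "CARD('p)"
  have p: "1 < ?p" using padic_prime_gt_1[where 'p = 'p] by simp
  have s0: "s 0 = 1" by (simp add: s_def wsum_0)
  have Z0: "0 \<notin> Z"
    using Z s0 uniformizer_not_unit by metis
  show ?case
  proof (cases "n = 0")
    case True
    then show ?thesis by (simp add: dc_def digit_count_0[OF Z0])
  next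
    case False
    define m where "m = n div ?p"
    define v where "v = n mod ?p"
    have n: "n = v + ?p * m" and v: "v < ?p" using p by (simp_all add: m_def v_def)
    have "m < n" using False p by (simp add: m_def)
    have B: "\<pi> ^ dc m dvd wsum e g (w + ?p * m)"
      if "lip 0 g" "w < ?p" for g :: "_ \<Rightarrow> 'p padic_int" and w
      using wsum_step[OF adm Z0 that(1), of m w] less[of m] less[OF le_less_trans, OF _ \<open>m < n\<close>]
        \<open>m < n\<close> that(2) unfolding dc_def s_def by blast
    have Bs: "\<pi> ^ dc m dvd s (w + ?p * m)" if "w < ?p" for w
      unfolding s_def using that by (intro B) simp_all
    have "\<pi> ^ dc n dvd s n"
    proof (cases "v \<in> Z")
      case False
      then have "dc n = dc m" using digit_count_div[OF p Z0, of n] by (simp add: dc_def m_def v_def)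
      then show ?thesis using Bs[OF v] n by simp
    next
      case True
      then have dc: "dc n = Suc (dc m)"
        using digit_count_div[OF p Z0, of n] by (simp add: dc_def m_def v_def)
      have "unit_preserving (P 0)" using type by (auto simp: type_I_def type_II_def)
      have "\<pi> ^ Suc (dc m) dvd s (v + ?p * m) - s v * s (?p * m)"
      proof (rule recurrence_congruence[OF rec s0 \<open>unit_preserving (P 0)\<close> Bs _ v order_refl])
        fix w k assume w: "1 \<le> w" "w \<le> v" "w < k" "k \<le> q" "k \<le> w + ?p * m"
        show "\<pi> ^ Suc (dc m) dvd poly (P k) (of_nat (w + ?p * m - k)) * s (w + ?p * m - k)"
          unfolding dc_def
        proof (rule high_terms_dvd[OF Z0 type])
          fix n' assume "n' < w + ?p * m"
          \<comment> \<open>Stopping at \<open>w \<le> v\<close> keeps all indices below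
            \<open>n\<close>, where the induction hypothesis is available.\<close>
          then have "n' < n" using w n by simp
          then show "\<pi> ^ digit_count ?p Z n' dvd s n'" using less.IH by (simp add: dc_def)
        qed (use w v in simp_all)
      qed
      moreover have "\<pi> * \<pi> ^ dc m dvd s v * s (?p * m)"
        using True Z Bs[of 0] by (intro mult_dvd_mono) auto
      ultimately have "\<pi> ^ Suc (dc m) dvd (s (v + ?p * m) - s v * s (?p * m)) + s v * s (?p * m)"
        by (intro dvd_add) simp_all
      then show ?thesis by (simp add: dc flip: n)
    qed
    moreover have "\<pi> ^ dc (n div ?p) dvd wsum e g n" if "lip 0 g" for g :: "_ \<Rightarrow> 'p padic_int"
      using B[OF that v] by (simp only: n[symmetric] m_def[symmetric])
    ultimately show ?thesis by blast
  qed
qed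

section \<open>Return to the fraction field and to the integers\<close>

lemma to_fract_in_padic_ideal_iff:
  "to_fract (x :: 'p::prime_card padic_int) \<in> padic_ideal (int k) \<longleftrightarrow> \<pi> ^ k dvd x"
proof -
  have eq: "of_nat CARD('p) powi int k * to_fract y = to_fract (\<pi> ^ k * y)" for y :: "'p padic_int"
    by (simp add: to_fract_power to_fract_of_nat)
  show ?thesis
    unfolding padic_ideal_def eq image_iff to_fract_eq_iff dvd_def by simp
qed

text \<open>For \<open>k = 0\<close> the exponent is -1 and the fractional ideal contains every
  p-adic integer, as \<open>x\<close> is \<open>p powi -1\<close> times
  \<open>\<pi> * x\<close>.\<close>

lemma to_fract_in_padic_ideal_diff_1:
  assumes "\<pi> ^ k dvd \<pi> * (x :: 'p::prime_card padic_int)"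
  shows "to_fract x \<in> padic_ideal (int k - 1)"
proof (cases k)
  case (Suc k')
  then show ?thesis
    using assms padic_prime_pos[where 'p = 'p] to_fract_in_padic_ideal_iff[of x k'] by auto
next
  case 0
  have "to_fract x = of_nat CARD('p) powi (int k - 1) * to_fract (\<pi> * x)"
    using padic_prime_pos[where 'p = 'p] by (simp add: 0 to_fract_of_nat)
  then show ?thesis unfolding padic_ideal_def by blast
qed

text \<open>Positions with \<open>p ^ k > n\<close> carry the digit 0, which is not counted.\<close>

lemma zero_digit_count_eq:
  fixes A :: "nat \<Rightarrow> 'p::prime_card padic"
  assumes "0 \<notin> zero_digits A"
  shows "zero_digit_count A n = digit_count CARD('p) (zero_digits A) n"
proof -
  have "k = 0 \<or> CARD('p) ^ k \<le> n" if "n div CARD('p) ^ k mod CARD('p) \<in> zero_digits A" for k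
    using that assms by (cases "n < CARD('p) ^ k") auto
  then show ?thesis unfolding zero_digit_count_def digit_count_def by metis
qed

theorem theorem1:
  fixes e f :: "(nat ^ 'd) list"
    and ks :: "'d list"
    and q :: nat
    and P :: "nat \<Rightarrow> 'p::prime_card padic_int poly"
    and S :: "nat \<Rightarrow> 'p padic"
  defines "S \<equiv> (\<lambda>m. of_rat (fact_quot_sum e f m))"
  assumes "f = map (\<lambda>k. axis k 1) ks"
    and "set e \<inter> set f = {}"
    and "sum_list e = sum_list f"
    and "admissible 2 e"
    and "diff_op q P (Abs_fps S) = 0"
    and "type_I q P \<or> (type_II q P \<and> CARD('p) - 1 \<in> zero_digits S)"
  shows "\<forall>n. (\<exists>k::int. fact_quot_sum e f n = of_nat CARD('p) ^ zero_digit_count S n * of_int k) \<and>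
    (\<forall>g \<in> (poly_limits :: (nat ^ 'd \<Rightarrow> 'p padic_int) set).
      fact_quot_sum_weighted e f g n \<in> padic_ideal (int (zero_digit_count S n) - 1))"
proof -
  let ?p = "CARD('p)"
  have p: "1 < ?p" using padic_prime_gt_1[where 'p = 'p] by simp
  define s where "s = wsum e (\<lambda>_. 1 :: 'p padic_int)"
  \<comment> \<open>The sums as natural numbers: for them p-adic divisibility by a power of p is
    ordinary divisibility, which yields an integer quotient.\<close>
  define t where "t m = (\<Sum>n | weight n = m. multinom_prod e n)" for m
  define Z where "Z = zero_digits S"
  note quot = fact_quot_eq_multinom_prod[OF assms(2,4)]
  have fqs: "fact_quot_sum e f m = of_nat (t m)" for m
    by (simp add: fact_quot_sum_def quot t_def)
  have st: "s m = of_nat (t m)" for m by (simp add: s_def wsum_def t_def)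
  have S: "S = (\<lambda>m. to_fract (s m))" by (simp add: S_def fqs st to_fract_of_nat)
  have Z: "v \<in> Z \<longleftrightarrow> v < ?p \<and> \<pi> dvd s v" for v
  proof -
    have "v \<in> Z \<longleftrightarrow> v \<le> ?p - 1 \<and> to_fract (s v) \<in> padic_ideal (int 1)"
      by (simp add: Z_def zero_digits_def S)
    also have "\<dots> \<longleftrightarrow> v < ?p \<and> \<pi> dvd s v"
      using p by (subst to_fract_in_padic_ideal_iff) auto
    finally show ?thesis .
  qed
  have Z0: "0 \<notin> Z" using Z uniformizer_not_unit by (auto simp: s_def wsum_0)
  have count: "zero_digit_count S n = digit_count ?p Z n" for n
    using zero_digit_count_eq[of S] Z0 by (simp add: Z_def)
  have rec: "(\<Sum>k\<le>min q n. poly (P k) (of_nat (n - k)) * s (n - k)) = 0" for n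
    by (rule diff_op_recurrence) (use assms(6) in \<open>simp add: S\<close>)
  have main: "\<pi> ^ digit_count ?p Z n dvd s n"
    "\<And>g :: _ \<Rightarrow> 'p padic_int. lip 0 g \<Longrightarrow> \<pi> ^ digit_count ?p Z (n div ?p) dvd wsum e g n" for n
    using wsum_main[OF assms(5) _ Z[unfolded s_def] rec[unfolded s_def] assms(7)[folded Z_def], of n]
    by (auto simp: s_def)
  show ?thesis
  proof (intro allI conjI ballI)
    fix n
    have "?p ^ digit_count ?p Z n dvd t n"
      using main(1)[of n] unfolding st of_nat_dvd_padic_int_iff .
    then obtain k where "t n = ?p ^ digit_count ?p Z n * k" by (rule dvdE)
    then have "fact_quot_sum e f n = of_nat ?p ^ zero_digit_count S n * of_int (int k)"
      by (simp add: fqs count)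
    then show "\<exists>k::int. fact_quot_sum e f n = of_nat ?p ^ zero_digit_count S n * of_int k" ..
  next
    fix n and g :: "nat ^ 'd \<Rightarrow> 'p padic_int"
    assume "g \<in> poly_limits"
    then have B: "\<pi> ^ digit_count ?p Z (n div ?p) dvd wsum e g n"
      by (intro main(2) lip_poly_limits)
    \<comment> \<open>Dropping the last digit loses at most one; this is the 1 subtracted in the
      exponent.\<close>
    have "digit_count ?p Z n \<le> Suc (digit_count ?p Z (n div ?p))"
      using digit_count_div[OF p Z0, of n] by simp
    then have "\<pi> ^ digit_count ?p Z n dvd (\<pi> ^ Suc (digit_count ?p Z (n div ?p)) :: 'p padic_int)"
      by (rule le_imp_power_dvd)
    also have "\<dots> dvd \<pi> * wsum e g n" using B by (simp add: mult_dvd_mono)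
    finally have "to_fract (wsum e g n) \<in> padic_ideal (int (digit_count ?p Z n) - 1)"
      by (rule to_fract_in_padic_ideal_diff_1)
    moreover have "fact_quot_sum_weighted e f g n = to_fract (wsum e g n)"
      by (simp add: fact_quot_sum_weighted_def wsum_def quot to_fract_sum to_fract_of_nat)
    ultimately show "fact_quot_sum_weighted e f g n \<in> padic_ideal (int (zero_digit_count S n) - 1)"
      by (simp add: count)
  qed
qed

end
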